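(* Consider the quantum switch on the graph $G=(V,E)$ described in the context, with coherence factor $\Gamma'_{\mathrm{coh}}>0$ and capacity region $\mathcal C$, and let $\epsilon>0$. The simplified LP-based frame scheduling algorithm stabilizes every request arrival rate vector $\boldsymbol\nu=(\nu_e)_{e\in E}$ satisfying $$\frac{1+\epsilon}{\tfrac23\,\Gamma'_{\mathrm{coh}}}\,\boldsymbol\nu\in\mathcal C ,$$ in the following sense. With $\mathcal V(\mathbf R)=\frac12\sum_{e\in E}R_e^2$, there exist a frame length $T_\epsilon\in\{1,2,\dots\}$, a constant $\delta>0$ and a finite set $\mathcal B\subset\mathbb Z_{\ge0}^E$ such that, when the switch is operated under the simplified algorithm with frame length $T=T_\epsilon$, for all $k\in\{0,1,2,\dots\}$, $$\mathbb E\big[\mathcal V(\mathbf R((k+1)T_\epsilon))-\mathcal V(\mathbf R(kT_\epsilon))\,\big|\,\mathbf L(kT_\epsilon),\mathbf R(kT_\epsilon)\big]\le-\delta$$ whenever $\mathbf R(kT_\epsilon)\notin\mathcal B$.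
   Context: **Switch model.** $G=(V,E)$ is a finite graph; $\delta(v)$ denotes the set of edges incident to $v\in V$. The endpoints of $e$ are $u_e,v_e$. Time is slotted, $t=0,1,2,\dots$. Node $v$ stores $L_v(t)\in\{0,\dots,B_v\}$ entanglements, where $B_v\ge1$ is a finite integer. Edge $e$ has an infinite-buffer request queue $R_e(t)\in\mathbb Z_{\ge0}$. Parameters $\lambda_v,\mu_v\in(0,1)$ are given for each $v$. A matching is a set of edges no two of which share a node; $\mathcal M$ is the set of all matchings of $G$ and $\mathbf 1_M\in\{0,1\}^E$ is the indicator vector of $M$. Events in slot $t$ occur in this order: 1. A matching $M(t)\in\mathcal M$ is chosen. 2. Edge $e=(u,v)$ is served, $S_e(t)=1$, if and only if $e\in M(t)$, $R_e(t)>0$, $L_u(t)>0$ and $L_v(t)>0$; otherwise $S_e(t)=0$. A service removes one request from $R_e$ and one entanglement from each of $L_u,L_v$. 3. Each remaining entanglement at node $v$ is lost independently with probability $\mu_v$; let $D_v(t)\sim\mathrm{Binom}(L_v(t)-\sum_{e\in\delta(v)}S_e(t),\mu_v)$ be the number lost. 4. A new entanglement arrives at $v$ with probability $\lambda_v$ (Bernoulli variable $Y_v(t)$), and $A_e(t)\in\mathbb Z_{\ge0}$ requests arrive at edge $e$, where $A_e(t)$ is i.i.d. over $t$ with mean $\nu_e$ and finite variance $\sigma_e^2$. Thus $R_e(t+1)=R_e(t)-S_e(t)+A_e(t)$ and $L_v(t+1)=\min\big(B_v,\,L_v(t)-\sum_{e\in\delta(v)}S_e(t)-D_v(t)+Y_v(t)\big)$.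 Entanglement arrivals, decoherence events, request arrivals and scheduling randomness are mutually independent, and independent across nodes and slots. **Simplified LP-based frame scheduling algorithm with frame length $T$.** At each time $t=kT$, $k=0,1,2,\dots$, observe $\mathbf R(kT)$, set $w_e=R_e(kT)$, and let $\mathbf x^{\mathrm{frac}}$ be an optimal solution of the LP: maximize $\sum_ew_ex_e$ subject to $\sum_{e\in\delta(v)}x_e\le\lambda_v$ for all $v\in V$, and $x_e\ge0$ for all $e\in E$. Put $\mathbf x^{\mathrm{app}}=\frac23\mathbf x^{\mathrm{frac}}$, which lies in the convex hull of $\{\mathbf 1_M:M\in\mathcal M\}$. Compute probabilities $(p_M)_{M\in\mathcal M}$ with $p_M\ge0$, $\sum_Mp_M=1$ and $\sum_Mp_M\mathbf 1_M=\mathbf x^{\mathrm{app}}$ (the choice of $\mathbf x^{\mathrm{frac}}$ and $(p_M)$ being a function of $\mathbf R(kT)$). In each slot $t=kT,\dots,(k+1)T-1$, independently choose $M(t)=M$ with probability $p_M$. **Reference chain and coherence factor.** For node $u$, the reference chain on $\{0,\dots,B_u\}$ evolves as follows. From state $i$, draw independent $S\sim\mathrm{Bernoulli}(p_u)$ with $p_u=\frac23\lambda_u$ and $A\sim\mathrm{Bernoulli}(\lambda_u)$, draw $K\sim\mathrm{Binom}(\max(0,i-S),1-\mu_u)$ (independent of $A$ given $S$), and move to $\min(B_u,K+A)$. Let $C'_u=1-\pi_0$, where $\pi$ is its stationary distribution. Define $\Gamma'_{\mathrm{coh}}=\min_{e=(u,v)\in E}(C'_u+C'_v-1)^+$, where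 $x^+=\max(x,0)$. **Capacity region.** A request-agnostic policy $\pi$ chooses matching $M$ with probability $\pi(M\mid\mathbf L)$ when the entanglement state is $\mathbf L$. Under it, every edge of the chosen matching with both endpoint buffers nonempty is served (request-queue emptiness is ignored), so $\mathbf L(t)$ is a finite Markov chain evolving as $L_v(t+1)=\min\big(B_v,\,L_v(t)-\sum_{e\in\delta(v)}\hat S_e(t)-\hat D_v(t)+Y_v(t)\big)$ for all $v\in V$, where $M(t)=M$ with probability $\pi(M\mid\mathbf L(t))$, $\hat S_e(t)=1$ if $e\in M(t)$, $L_{u_e}(t)>0$ and $L_{v_e}(t)>0$, and $\hat S_e(t)=0$ otherwise, $\hat D_v(t)\sim\mathrm{Binom}(L_v(t)-\sum_{e\in\delta(v)}\hat S_e(t),\mu_v)$ and $Y_v(t)\sim\mathrm{Bernoulli}(\lambda_v)$, with scheduling, decoherence and entanglement-arrival randomness independent of each other and across nodes and slots; $d_\pi$ denotes its stationary distribution. Then $$\mathcal C=\Big\{\boldsymbol\nu\in\mathbb R_{\ge0}^E:\ \exists\,\pi\text{ such that }\nu_e<\sum_{\mathbf L:\,L_{u_e}>0,\,L_{v_e}>0}\ \sum_{M\ni e}\pi(M\mid\mathbf L)\,d_\pi(\mathbf L)\ \ \forall e\in E\Big\}.$$ *)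

theory Defs
  imports "HOL-Probability.Probability" "HOL-Library.Monad_Syntax"
begin

section \<open>Switches and their state spaces\<close>

text \<open>
  An edge is the two-element set of its endpoints. Vectors indexed by nodes or by edges are
  functions; state vectors (entanglement levels, request queues) vanish outside the index set,
  whereas rate vectors are unconstrained there.
\<close>

record 'v switch =
  nodes :: "'v set"
  edges :: "'v set set"
  buf :: "'v \<Rightarrow> nat"
  gen_prob :: "'v \<Rightarrow> real"   \<comment> \<open>\<open>\<lambda>\<^sub>v\<close>\<close>
  loss_prob :: "'v \<Rightarrow> real"  \<comment> \<open>\<open>\<mu>\<^sub>v\<close>\<close>

definition valid_switch :: "'v switch \<Rightarrow> bool" where
  "valid_switch G \<longleftrightarrow>
     finite (nodes G) \<and>
     (\<forall>e\<in>edges G. e \<subseteq> nodes G \<and> card e = 2) \<and>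
     (\<forall>v\<in>nodes G. 1 \<le> buf G v \<and>
        0 < gen_prob G v \<and> gen_prob G v < 1 \<and> 0 < loss_prob G v \<and> loss_prob G v < 1)"

definition incident :: "'v switch \<Rightarrow> 'v \<Rightarrow> 'v set set" where
  "incident G v = {e \<in> edges G. v \<in> e}"

definition matchings :: "'v switch \<Rightarrow> 'v set set set" where
  "matchings G = {M. M \<subseteq> edges G \<and> pairwise disjnt M}"

definition ent_states :: "'v switch \<Rightarrow> ('v \<Rightarrow> nat) set" where
  "ent_states G = PiE_dflt (nodes G) 0 (\<lambda>v. {0..buf G v})"

definition request_states :: "'v switch \<Rightarrow> ('v set \<Rightarrow> nat) set" where
  "request_states G = PiE_dflt (edges G) 0 (\<lambda>_. UNIV)"

type_synonym 'v state = "('v \<Rightarrow> nat) \<times> ('v set \<Rightarrow> nat)"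


section \<open>Slot dynamics\<close>

text \<open>
  The law of the request arrival vector of one slot. It is a joint law on the edges:
  arrivals are independent over slots, but no independence across edges is imposed.
\<close>

definition request_arrivals ::
  "'v switch \<Rightarrow> ('v set \<Rightarrow> real) \<Rightarrow> ('v set \<Rightarrow> nat) pmf \<Rightarrow> bool" where
  "request_arrivals G \<nu> arr \<longleftrightarrow>
     set_pmf arr \<subseteq> request_states G \<and>
     (\<forall>e\<in>edges G.
        integrable (measure_pmf arr) (\<lambda>a. real (a e)) \<and>
        measure_pmf.expectation arr (\<lambda>a. real (a e)) = \<nu> e \<and>
        integrable (measure_pmf arr) (\<lambda>a. (real (a e))\<^sup>2))"

definition service :: "'v set set \<Rightarrow> ('v \<Rightarrow> nat) \<Rightarrow> ('v set \<Rightarrow> nat) \<Rightarrow> 'v set \<Rightarrow> nat" where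
  "service M L R e = of_bool (e \<in> M \<and> 0 < R e \<and> (\<forall>v\<in>e. 0 < L v))"

text \<open>
  Decoherence and entanglement generation, given the services \<open>S\<close> of the slot. No subtraction
  truncates: the edges served lie in a matching and have nonempty endpoint buffers.
\<close>

definition entanglement_step ::
  "'v switch \<Rightarrow> ('v set \<Rightarrow> nat) \<Rightarrow> ('v \<Rightarrow> nat) \<Rightarrow> ('v \<Rightarrow> nat) pmf" where
  "entanglement_step G S L = do {
     D \<leftarrow> Pi_pmf (nodes G) 0
           (\<lambda>v. binomial_pmf (L v - (\<Sum>e\<in>incident G v. S e)) (loss_prob G v));
     Y \<leftarrow> Pi_pmf (nodes G) False (\<lambda>v. bernoulli_pmf (gen_prob G v));
     return_pmf (\<lambda>v. min (buf G v)
       (L v - (\<Sum>e\<in>incident G v. S e) - D v + of_bool (Y v)))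
   }"

definition slot ::
  "'v switch \<Rightarrow> ('v set \<Rightarrow> nat) pmf \<Rightarrow> 'v set set pmf \<Rightarrow> 'v state \<Rightarrow> 'v state pmf" where
  "slot G arr p X = (case X of (L, R) \<Rightarrow> do {
     M \<leftarrow> p;
     let S = service M L R;
     L' \<leftarrow> entanglement_step G S L;
     A \<leftarrow> arr;
     return_pmf (L', \<lambda>e. R e - S e + A e)
   })"


section \<open>The simplified LP-based frame scheduling algorithm\<close>

definition lp_feasible :: "'v switch \<Rightarrow> ('v set \<Rightarrow> real) \<Rightarrow> bool" where
  "lp_feasible G x \<longleftrightarrow>
     (\<forall>v\<in>nodes G. (\<Sum>e\<in>incident G v. x e) \<le> gen_prob G v) \<and> (\<forall>e\<in>edges G. 0 \<le> x e)"

definition lp_optimal :: "'v switch \<Rightarrow> ('v set \<Rightarrow> real) \<Rightarrow> ('v set \<Rightarrow> real) \<Rightarrow> bool" where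
  "lp_optimal G w x \<longleftrightarrow>
     lp_feasible G x \<and>
     (\<forall>y. lp_feasible G y \<longrightarrow> (\<Sum>e\<in>edges G. w e * y e) \<le> (\<Sum>e\<in>edges G. w e * x e))"

text \<open>
  \<open>sched R\<close> is the distribution \<open>(p\<^sub>M)\<close> computed from the request queues \<open>R\<close> observed at the
  beginning of a frame.
\<close>

definition simplified_scheduler ::
  "'v switch \<Rightarrow> (('v set \<Rightarrow> nat) \<Rightarrow> 'v set set pmf) \<Rightarrow> bool" where
  "simplified_scheduler G sched \<longleftrightarrow>
     (\<forall>R\<in>request_states G.
        set_pmf (sched R) \<subseteq> matchings G \<and>
        (\<exists>x. lp_optimal G (\<lambda>e. real (R e)) x \<and>
             (\<forall>e\<in>edges G.
                (\<Sum>M\<in>matchings G. pmf (sched R) M * indicator M e) = 2/3 * x e)))"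

text \<open>
  The joint law of the states \<open>X(0), \<dots>, X(t)\<close> under frame length \<open>T\<close>, as a distribution on
  lists of length \<open>t + 1\<close>. The frame containing slot \<open>t\<close> begins at slot \<open>t div T * T\<close>.
\<close>

primrec trajectory ::
  "'v switch \<Rightarrow> ('v set \<Rightarrow> nat) pmf \<Rightarrow> (('v set \<Rightarrow> nat) \<Rightarrow> 'v set set pmf) \<Rightarrow> nat \<Rightarrow>
   'v state pmf \<Rightarrow> nat \<Rightarrow> 'v state list pmf" where
  "trajectory G arr sched T init 0 = map_pmf (\<lambda>X. [X]) init"
| "trajectory G arr sched T init (Suc t) = do {
     h \<leftarrow> trajectory G arr sched T init t;
     X \<leftarrow> slot G arr (sched (snd (h ! (t div T * T)))) (h ! t);
     return_pmf (h @ [X])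
   }"

definition lyapunov :: "'v switch \<Rightarrow> ('v set \<Rightarrow> nat) \<Rightarrow> real" where
  "lyapunov G R = 1/2 * (\<Sum>e\<in>edges G. (real (R e))\<^sup>2)"


section \<open>Reference chains and coherence factor\<close>

definition stationary_distribution :: "'s set \<Rightarrow> ('s \<Rightarrow> 's pmf) \<Rightarrow> 's pmf" where
  "stationary_distribution \<Omega> K = (THE d. set_pmf d \<subseteq> \<Omega> \<and> bind_pmf d K = d)"

definition reference_step :: "'v switch \<Rightarrow> 'v \<Rightarrow> nat \<Rightarrow> nat pmf" where
  "reference_step G u i = do {
     S \<leftarrow> bernoulli_pmf (2/3 * gen_prob G u);
     A \<leftarrow> bernoulli_pmf (gen_prob G u);
     K \<leftarrow> binomial_pmf (i - of_bool S) (1 - loss_prob G u);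
     return_pmf (min (buf G u) (K + of_bool A))
   }"

definition node_coherence :: "'v switch \<Rightarrow> 'v \<Rightarrow> real" where
  "node_coherence G u =
     1 - pmf (stationary_distribution {0..buf G u} (reference_step G u)) 0"

definition coherence_factor :: "'v switch \<Rightarrow> real" where
  "coherence_factor G =
     Min {max (node_coherence G u + node_coherence G v - 1) 0 | u v. {u, v} \<in> edges G}"


section \<open>Capacity region\<close>

definition agnostic_policy :: "'v switch \<Rightarrow> (('v \<Rightarrow> nat) \<Rightarrow> 'v set set pmf) \<Rightarrow> bool" where
  "agnostic_policy G \<pi> \<longleftrightarrow> (\<forall>L\<in>ent_states G. set_pmf (\<pi> L) \<subseteq> matchings G)"

definition agnostic_service :: "'v set set \<Rightarrow> ('v \<Rightarrow> nat) \<Rightarrow> 'v set \<Rightarrow> nat" where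
  "agnostic_service M L e = of_bool (e \<in> M \<and> (\<forall>v\<in>e. 0 < L v))"

definition agnostic_step ::
  "'v switch \<Rightarrow> (('v \<Rightarrow> nat) \<Rightarrow> 'v set set pmf) \<Rightarrow> ('v \<Rightarrow> nat) \<Rightarrow> ('v \<Rightarrow> nat) pmf" where
  "agnostic_step G \<pi> L = do {
     M \<leftarrow> \<pi> L;
     entanglement_step G (agnostic_service M L) L
   }"

definition capacity_region :: "'v switch \<Rightarrow> ('v set \<Rightarrow> real) set" where
  "capacity_region G = {\<nu>.
     (\<forall>e\<in>edges G. 0 \<le> \<nu> e) \<and>
     (\<exists>\<pi>. agnostic_policy G \<pi> \<and>
        (\<forall>e\<in>edges G.
           \<nu> e < (\<Sum>L\<in>{L \<in> ent_states G. \<forall>v\<in>e. 0 < L v}.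
                   \<Sum>M\<in>{M \<in> matchings G. e \<in> M}.
                     pmf (\<pi> L) M *
                     pmf (stationary_distribution (ent_states G) (agnostic_step G \<pi>)) L)))}"

end

theory Submission
  imports Defs
begin

text \<open>
  The proof is a drift argument over one frame of length \<open>T\<close>. Fix the state \<open>(l, r)\<close> at the
  beginning of a frame, and let \<open>x\<close> be the optimal LP solution for the weights \<open>r\<close>.

  Availability of entanglements. In every slot the matching covers node \<open>u\<close> with probability at
  most \<open>2/3 \<lambda>\<^sub>u\<close>, independently of the state. Hence the level at \<open>u\<close> stochastically dominates the
  reference chain, which is monotone (\<open>frame_dominates_reference\<close>). The reference chain can empty
  its buffer in one step from everywhere, so by Doeblin's argument it has a unique stationary
  distribution, to which it converges geometrically. Over the frame, buffer \<open>u\<close> is therefore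
  nonempty for an expected time of at least \<open>T C'\<^sub>u - H\<close>, with \<open>H\<close> independent of \<open>T\<close>, \<open>u\<close> and
  the initial level (\<open>reference_occupation\<close>). By a union bound both buffers of an edge are
  nonempty for an expected time of at least \<open>T \<Gamma> - 2 H\<close>, where \<open>\<Gamma>\<close> is the coherence factor.

  Upper bound on the capacity. In stationarity no node consumes more entanglements than it
  generates, so the service rates of any request-agnostic policy form a feasible point \<open>y\<close> of the
  LP (\<open>agnostic_rates_lp_feasible\<close>; this chain is of Doeblin type, too, so its
  stationary distribution is well defined). Hence \<open>\<Sum>\<^sub>e r\<^sub>e y\<^sub>e \<le> \<Sum>\<^sub>e r\<^sub>e x\<^sub>e\<close>.

  Drift. Expanding the squares, the expected change of the Lyapunov function is at most
  \<open>\<Sum>\<^sub>e r\<^sub>e (T \<nu>\<^sub>e - 2/3 x\<^sub>e (T \<Gamma> - 2 H))\<close> plus a constant independent of \<open>(l, r)\<close>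
  (\<open>frame_lyapunov_drift\<close>). This constant contains the second moments of the increments and, for
  the queues shorter than \<open>T\<close>, which may run empty, a term \<open>T\<^sup>2\<close>. For \<open>T\<close> large enough
  \<open>T \<Gamma> - 2 H \<ge> T \<Gamma> / (1 + \<epsilon>)\<close>. With \<open>\<kappa> = 2/3 \<Gamma> / (1 + \<epsilon>)\<close> and \<open>\<nu> / \<kappa> + \<eta> \<le> y\<close> for some
  \<open>\<eta> > 0\<close>, the sum is at most \<open>- T \<kappa> \<eta> \<Sum>\<^sub>e r\<^sub>e\<close>, which outweighs the constant for all but
  finitely many \<open>r\<close> (\<open>frame_drift_bound\<close>).

  Finally, given the state at the beginning of a frame, the trajectory is a Markov chain run for
  \<open>T\<close> steps (\<open>cond_trajectory_expectation\<close>), which turns this bound into one on the conditional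
  expectation.
\<close>

section \<open>Expectations under mixtures\<close>

text \<open>
  A nonnegative function is integrable under a mixture if it is integrable under each component,
  with expectations bounded by an integrable function. This matters for the request queues,
  which are unbounded.
\<close>

lemma integrable_bind_pmf_nonneg:
  fixes f :: "'b \<Rightarrow> real" and g :: "'a \<Rightarrow> real"
  assumes nn: "\<And>y. 0 \<le> f y"
    and int: "\<And>x. x \<in> set_pmf D \<Longrightarrow> integrable (measure_pmf (K x)) f"
    and le: "\<And>x. x \<in> set_pmf D \<Longrightarrow> measure_pmf.expectation (K x) f \<le> g x"
    and g: "integrable (measure_pmf D) g"
  shows "integrable (measure_pmf (bind_pmf D K)) f"
proof (rule integrableI_nonneg)
  have "(\<integral>\<^sup>+y. ennreal (f y) \<partial>bind_pmf D K) = (\<integral>\<^sup>+x. \<integral>\<^sup>+y. ennreal (f y) \<partial>K x \<partial>D)"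
    by simp
  also have "\<dots> \<le> (\<integral>\<^sup>+x. ennreal (g x) \<partial>D)"
  proof (rule nn_integral_mono_AE, rule AE_pmfI)
    fix x assume x: "x \<in> set_pmf D"
    have "(\<integral>\<^sup>+y. ennreal (f y) \<partial>K x) = ennreal (measure_pmf.expectation (K x) f)"
      by (rule nn_integral_eq_integral) (use int[OF x] nn in auto)
    thus "(\<integral>\<^sup>+y. ennreal (f y) \<partial>K x) \<le> ennreal (g x)"
      using le[OF x] by (simp add: ennreal_leI)
  qed
  also have "\<dots> < \<infinity>"
    using g integrableD(2) by (auto simp: real_integrable_def top.not_eq_extremum)
  finally show "(\<integral>\<^sup>+y. ennreal (f y) \<partial>bind_pmf D K) < \<infinity>" .
qed (use nn in auto)

lemma expectation_bind_pmf_nonneg: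
  fixes f :: "'b \<Rightarrow> real"
  assumes nn: "\<And>y. 0 \<le> f y"
    and f: "integrable (measure_pmf (bind_pmf D K)) f"
    and int: "\<And>x. x \<in> set_pmf D \<Longrightarrow> integrable (measure_pmf (K x)) f"
  shows "measure_pmf.expectation (bind_pmf D K) f =
         measure_pmf.expectation D (\<lambda>x. measure_pmf.expectation (K x) f)"
proof -
  have "ennreal (measure_pmf.expectation (bind_pmf D K) f) = (\<integral>\<^sup>+x. \<integral>\<^sup>+y. ennreal (f y) \<partial>K x \<partial>D)"
    by (subst nn_integral_eq_integral[symmetric]) (use f nn in auto)
  also have "\<dots> = (\<integral>\<^sup>+x. ennreal (measure_pmf.expectation (K x) f) \<partial>D)"
    by (intro nn_integral_cong_AE AE_pmfI nn_integral_eq_integral) (use int nn in auto)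
  finally have "(\<integral>\<^sup>+x. ennreal (measure_pmf.expectation (K x) f) \<partial>D)
      = ennreal (measure_pmf.expectation (bind_pmf D K) f)" ..
  thus ?thesis
    by (subst (2) integral_eq_nn_integral) (simp_all add: nn integral_nonneg)
qed

lemma integrable_pmf_bounded:
  fixes f :: "'a \<Rightarrow> real"
  assumes "\<And>y. \<bar>f y\<bar> \<le> B"
  shows "integrable (measure_pmf D) f"
  by (rule measure_pmf.integrable_const_bound[where B = B]) (use assms in auto)

lemma expectation_pmf_mono:
  fixes f g :: "'a \<Rightarrow> real"
  assumes "integrable (measure_pmf D) f" "integrable (measure_pmf D) g"
    and "\<And>x. x \<in> set_pmf D \<Longrightarrow> f x \<le> g x"
  shows "measure_pmf.expectation D f \<le> measure_pmf.expectation D g"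
  by (rule integral_mono_AE) (use assms in \<open>auto intro: AE_pmfI\<close>)

lemma expectation_pmf_bounds:
  fixes f :: "'a \<Rightarrow> real"
  assumes "finite (set_pmf D)" "\<And>x. x \<in> set_pmf D \<Longrightarrow> a \<le> f x \<and> f x \<le> b"
  shows "a \<le> measure_pmf.expectation D f" "measure_pmf.expectation D f \<le> b"
proof -
  have "measure_pmf.expectation D (\<lambda>_. a) \<le> measure_pmf.expectation D f"
       "measure_pmf.expectation D f \<le> measure_pmf.expectation D (\<lambda>_. b)"
    by (rule expectation_pmf_mono; use assms in \<open>auto intro: integrable_measure_pmf_finite\<close>)+
  thus "a \<le> measure_pmf.expectation D f" "measure_pmf.expectation D f \<le> b"
    by simp_all
qed

lemma abs_expectation_pmf_le:
  fixes f :: "'a \<Rightarrow> real"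
  assumes "\<And>y. \<bar>f y\<bar> \<le> B"
  shows "\<bar>measure_pmf.expectation D f\<bar> \<le> B"
proof -
  have f: "integrable (measure_pmf D) f"
    by (rule integrable_pmf_bounded) (rule assms)
  have bd: "f y \<le> B" "- B \<le> f y" for y
    using assms[of y] by linarith+
  have "measure_pmf.expectation D f \<le> measure_pmf.expectation D (\<lambda>_. B)"
    by (rule expectation_pmf_mono) (use f bd in auto)
  moreover have "measure_pmf.expectation D (\<lambda>_. - B) \<le> measure_pmf.expectation D f"
    by (rule expectation_pmf_mono) (use f bd in auto)
  ultimately show ?thesis by simp
qed

lemma expectation_bind_pmf_bounded:
  fixes f :: "'b \<Rightarrow> real"
  assumes B: "\<And>y. \<bar>f y\<bar> \<le> B"
  shows "measure_pmf.expectation (bind_pmf D K) f =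
         measure_pmf.expectation D (\<lambda>x. measure_pmf.expectation (K x) f)"
proof -
  have f: "integrable (measure_pmf D') f" for D' :: "'b pmf"
    by (rule integrable_pmf_bounded) (rule B)
  have "measure_pmf.expectation (bind_pmf D K) (\<lambda>y. f y + B) =
        measure_pmf.expectation D (\<lambda>x. measure_pmf.expectation (K x) (\<lambda>y. f y + B))"
  proof (rule expectation_bind_pmf_nonneg)
    show "0 \<le> f y + B" for y using B[of y] by linarith
  qed (use f in auto)
  moreover have "integrable (measure_pmf D) (\<lambda>x. measure_pmf.expectation (K x) f)"
    by (rule integrable_pmf_bounded, rule abs_expectation_pmf_le, rule B)
  ultimately show ?thesis
    using f by simp
qed

lemma expectation_bind_pmf_finite:
  fixes f :: "'b \<Rightarrow> real"
  assumes "finite (set_pmf D)" "\<And>x. x \<in> set_pmf D \<Longrightarrow> finite (set_pmf (K x))"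
  shows "measure_pmf.expectation (bind_pmf D K) f =
         measure_pmf.expectation D (\<lambda>x. measure_pmf.expectation (K x) f)"
proof -
  have "measure_pmf.expectation (bind_pmf D K) f =
      (\<Sum>a\<in>set_pmf D. pmf D a *\<^sub>R measure_pmf.expectation (K a) f)"
    by (rule pmf_expectation_bind) (use assms in auto)
  also have "\<dots> = measure_pmf.expectation D (\<lambda>x. measure_pmf.expectation (K x) f)"
    by (rule integral_measure_pmf[symmetric]) (use assms in auto)
  finally show ?thesis .
qed

section \<open>Finite Markov chains with a uniformly reachable state\<close>

text \<open>
  The law after \<open>n\<close> steps of the Markov chain with kernel \<open>K\<close> started in \<open>x\<close>.
\<close>

primrec iter_pmf :: "('s \<Rightarrow> 's pmf) \<Rightarrow> nat \<Rightarrow> 's \<Rightarrow> 's pmf" where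
  "iter_pmf K 0 x = return_pmf x"
| "iter_pmf K (Suc n) x = bind_pmf (iter_pmf K n x) K"

lemma iter_pmf_add: "iter_pmf K (m + n) x = bind_pmf (iter_pmf K m x) (iter_pmf K n)"
proof (induction n)
  case 0 show ?case by (simp add: bind_return_pmf')
next
  case (Suc n)
  thus ?case by (simp add: bind_assoc_pmf)
qed

lemma stationary_bind_iter_pmf:
  assumes "bind_pmf d K = d"
  shows "bind_pmf d (iter_pmf K n) = d"
proof (induction n)
  case 0 show ?case by (simp add: bind_return_pmf')
next
  case (Suc n)
  have "bind_pmf d (iter_pmf K (Suc n)) = bind_pmf (bind_pmf d (iter_pmf K n)) K"
    by (simp add: bind_assoc_pmf cong: bind_pmf_cong)
  thus ?case by (simp only: Suc assms)
qed

lemma set_iter_pmf_invariant: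
  assumes "\<And>x. x \<in> \<Omega> \<Longrightarrow> set_pmf (K x) \<subseteq> \<Omega>" and "x \<in> \<Omega>"
  shows "set_pmf (iter_pmf K n x) \<subseteq> \<Omega>"
  by (induction n) (use assms in auto)

text \<open>
  A finite Markov chain with a state \<open>z\<close> that every state reaches in one step with positive
  probability. Such a chain has exactly one stationary distribution and converges to it geometrically, uniformly in
  the starting state.
\<close>

locale doeblin_chain =
  fixes \<Omega> :: "'s set" and K :: "'s \<Rightarrow> 's pmf" and z :: 's
  assumes finite_states: "finite \<Omega>"
    and closed: "\<And>x. x \<in> \<Omega> \<Longrightarrow> set_pmf (K x) \<subseteq> \<Omega>"
    and z: "z \<in> \<Omega>"
    and reach: "\<And>x. x \<in> \<Omega> \<Longrightarrow> z \<in> set_pmf (K x)"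
begin

text \<open>
  The contraction factor: the largest probability, over all starting states, of not being in
  \<open>z\<close> after one step.
\<close>

definition rate :: real where
  "rate = 1 - Min ((\<lambda>x. pmf (K x) z) ` \<Omega>)"

lemma minorization: "x \<in> \<Omega> \<Longrightarrow> 1 - rate \<le> pmf (K x) z"
  unfolding rate_def using finite_states by simp

lemma rate_bounds: "0 \<le> rate" "rate < 1"
proof -
  have "Min ((\<lambda>x. pmf (K x) z) ` \<Omega>) \<in> (\<lambda>x. pmf (K x) z) ` \<Omega>"
    using finite_states z by (intro Min_in) auto
  then obtain x where x: "x \<in> \<Omega>" "Min ((\<lambda>x. pmf (K x) z) ` \<Omega>) = pmf (K x) z" by auto
  show "rate < 1" unfolding rate_def x(2) using reach[OF x(1)] by (simp add: pmf_positive)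
  show "0 \<le> rate" unfolding rate_def x(2) by (simp add: pmf_le_1)
qed

lemma finite_K: "x \<in> \<Omega> \<Longrightarrow> finite (set_pmf (K x))"
  using closed finite_states by (meson finite_subset)

lemma iter_closed: "x \<in> \<Omega> \<Longrightarrow> set_pmf (iter_pmf K n x) \<subseteq> \<Omega>"
  by (rule set_iter_pmf_invariant) (use closed in auto)

lemma finite_iter: "x \<in> \<Omega> \<Longrightarrow> finite (set_pmf (iter_pmf K n x))"
  using iter_closed finite_states by (meson finite_subset)

text \<open>
  Each row of the kernel puts mass at least \<open>1 - rate\<close> on the common state \<open>z\<close>, so only a
  fraction \<open>rate\<close> of the oscillation of \<open>f\<close> survives a step.
\<close>

lemma one_step_contraction:
  fixes f :: "'s \<Rightarrow> real"
  assumes f: "\<And>x. x \<in> \<Omega> \<Longrightarrow> a \<le> f x \<and> f x \<le> a + w" and x: "x \<in> \<Omega>"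
  defines "b \<equiv> (1 - rate) * f z + rate * a"
  shows "b \<le> measure_pmf.expectation (K x) f \<and> measure_pmf.expectation (K x) f \<le> b + rate * w"
proof -
  have *: "(1 - rate) * g z \<le> measure_pmf.expectation (K x) g"
    if g: "\<And>y. y \<in> \<Omega> \<Longrightarrow> 0 \<le> g y" for g :: "'s \<Rightarrow> real"
  proof -
    have "(1 - rate) * g z \<le> pmf (K x) z * g z"
      by (rule mult_right_mono) (use minorization[OF x] g z in auto)
    also have "\<dots> \<le> (\<Sum>y\<in>\<Omega>. pmf (K x) y * g y)"
      by (rule member_le_sum) (use z finite_states g in auto)
    also have "\<dots> = measure_pmf.expectation (K x) g"
      using closed[OF x] finite_states by (subst integral_measure_pmf[of \<Omega>]) auto
    finally show ?thesis .
  qed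
  have int: "integrable (measure_pmf (K x)) h" for h :: "'s \<Rightarrow> real"
    by (rule integrable_measure_pmf_finite) (rule finite_K[OF x])
  have 1: "(1 - rate) * (f z - a) \<le> measure_pmf.expectation (K x) f - a"
    using *[of "\<lambda>y. f y - a"] f int by (simp add: Bochner_Integration.integral_diff)
  have 2: "(1 - rate) * (a + w - f z) \<le> a + w - measure_pmf.expectation (K x) f"
    using *[of "\<lambda>y. a + w - f y"] f int by (simp add: Bochner_Integration.integral_diff)
  show ?thesis unfolding b_def using 1 2 by (simp add: algebra_simps)
qed

lemma iter_contraction:
  fixes f :: "'s \<Rightarrow> real"
  assumes "\<And>x. x \<in> \<Omega> \<Longrightarrow> a \<le> f x \<and> f x \<le> a + w"
  shows "\<exists>b. \<forall>x\<in>\<Omega>. b \<le> measure_pmf.expectation (iter_pmf K n x) f \<and>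
                     measure_pmf.expectation (iter_pmf K n x) f \<le> b + rate ^ n * w"
  using assms
proof (induction n arbitrary: f a w)
  case 0
  thus ?case by auto
next
  case (Suc n)
  define g where "g = (\<lambda>x. measure_pmf.expectation (K x) f)"
  have "\<exists>b. \<forall>x\<in>\<Omega>. b \<le> measure_pmf.expectation (iter_pmf K n x) g \<and>
          measure_pmf.expectation (iter_pmf K n x) g \<le> b + rate ^ n * (rate * w)"
    unfolding g_def
    by (rule Suc.IH, rule one_step_contraction) (use Suc.prems in auto)
  then obtain b where "\<forall>x\<in>\<Omega>. b \<le> measure_pmf.expectation (iter_pmf K n x) g \<and>
                     measure_pmf.expectation (iter_pmf K n x) g \<le> b + rate ^ n * (rate * w)"
    by blast
  moreover have "measure_pmf.expectation (iter_pmf K (Suc n) x) f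
      = measure_pmf.expectation (iter_pmf K n x) g" if "x \<in> \<Omega>" for x
    unfolding g_def iter_pmf.simps
    by (rule expectation_bind_pmf_finite)
       (use finite_iter[OF that] finite_K iter_closed[OF that, of n] in \<open>auto simp: subset_iff\<close>)
  ultimately show ?case
    by (intro exI[of _ b]) (simp add: mult_ac)
qed

lemma expectation_bind_iter_diff:
  fixes f :: "'s \<Rightarrow> real"
  assumes f: "\<And>x. x \<in> \<Omega> \<Longrightarrow> 0 \<le> f x \<and> f x \<le> 1"
    and d: "set_pmf d \<subseteq> \<Omega>" "set_pmf d' \<subseteq> \<Omega>"
  shows "\<bar>measure_pmf.expectation (bind_pmf d (iter_pmf K n)) f -
          measure_pmf.expectation (bind_pmf d' (iter_pmf K n)) f\<bar> \<le> rate ^ n"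
proof -
  obtain b where b: "\<forall>x\<in>\<Omega>. b \<le> measure_pmf.expectation (iter_pmf K n x) f \<and>
                     measure_pmf.expectation (iter_pmf K n x) f \<le> b + rate ^ n"
    using iter_contraction[of 0 f 1 n] f by auto
  have "b \<le> measure_pmf.expectation (bind_pmf D (iter_pmf K n)) f \<and>
        measure_pmf.expectation (bind_pmf D (iter_pmf K n)) f \<le> b + rate ^ n"
    if D: "set_pmf D \<subseteq> \<Omega>" for D
  proof -
    have fin: "finite (set_pmf D)" using D finite_states finite_subset by blast
    have "measure_pmf.expectation (bind_pmf D (iter_pmf K n)) f
        = measure_pmf.expectation D (\<lambda>x. measure_pmf.expectation (iter_pmf K n x) f)"
      by (rule expectation_bind_pmf_finite) (use finite_iter D fin in auto)
    thus ?thesis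
      using expectation_pmf_bounds[OF fin, of b "\<lambda>x. measure_pmf.expectation (iter_pmf K n x) f" "b + rate ^ n"]
        b D by auto
  qed
  from this[OF d(1)] this[OF d(2)] show ?thesis by linarith
qed

lemma pmf_iter_diff:
  assumes "set_pmf d \<subseteq> \<Omega>" "set_pmf d' \<subseteq> \<Omega>"
  shows "\<bar>pmf (bind_pmf d (iter_pmf K n)) j - pmf (bind_pmf d' (iter_pmf K n)) j\<bar> \<le> rate ^ n"
  using expectation_bind_iter_diff[of "indicator {j}", OF _ assms, of n]
  by (simp add: measure_pmf_single)

lemma rate_tendsto_0: "(\<lambda>n. rate ^ n) \<longlonglongrightarrow> 0"
  using rate_bounds by (intro LIMSEQ_realpow_zero) auto

lemma stationary_unique:
  assumes "set_pmf d \<subseteq> \<Omega>" "bind_pmf d K = d" "set_pmf d' \<subseteq> \<Omega>" "bind_pmf d' K = d'"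
  shows "d = d'"
proof (rule pmf_eqI)
  fix j
  have "\<bar>pmf d j - pmf d' j\<bar> \<le> rate ^ n" for n
    using pmf_iter_diff[OF assms(1,3), of n j]
    by (simp add: stationary_bind_iter_pmf assms)
  hence "\<bar>pmf d j - pmf d' j\<bar> \<le> 0"
    using rate_tendsto_0 by (intro LIMSEQ_le_const) auto
  thus "pmf d j = pmf d' j" by simp
qed

text \<open>
  The laws of the chain started in \<open>z\<close> form a Cauchy sequence, because the law after
  \<open>k + n\<close> steps is that after \<open>n\<close> steps from another initial law. The pointwise limit is
  stationary.
\<close>

lemma stationary_exists: "\<exists>d. set_pmf d \<subseteq> \<Omega> \<and> bind_pmf d K = d"
proof -
  define q where "q = (\<lambda>n. pmf (iter_pmf K n z))"
  have cauchy: "\<bar>q (k + n) j - q n j\<bar> \<le> rate ^ n" for k n j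
    using pmf_iter_diff[of "iter_pmf K k z" "return_pmf z" n j] iter_closed[OF z] z
    by (simp add: q_def iter_pmf_add bind_return_pmf)
  have "\<exists>l. (\<lambda>n. q n j) \<longlonglongrightarrow> l" for j
  proof -
    have "Cauchy (\<lambda>n. q n j)"
    proof (rule CauchyI')
      fix e :: real assume "0 < e"
      then obtain N where "rate ^ N < e"
        using rate_bounds real_arch_pow_inv by blast
      hence N: "rate ^ n < e" if "n \<ge> N" for n
        using power_decreasing[OF that, of rate] rate_bounds by auto
      show "\<exists>M. \<forall>m\<ge>M. \<forall>n>m. dist (q m j) (q n j) < e"
      proof (intro exI[of _ N] allI impI)
        fix m n assume mn: "N \<le> m" "m < n"
        then obtain k where "n = k + m" by (metis add.commute less_imp_add_positive)
        thus "dist (q m j) (q n j) < e"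
          using cauchy[of k m j] N[OF mn(1)] by (simp add: dist_real_def abs_minus_commute)
      qed
    qed
    thus ?thesis by (simp add: Cauchy_convergent_iff convergent_def)
  qed
  hence "\<exists>l. \<forall>j. (\<lambda>n. q n j) \<longlonglongrightarrow> l j" by (intro choice allI)
  then obtain l where l: "\<And>j. (\<lambda>n. q n j) \<longlonglongrightarrow> l j" by blast
  have nonneg: "0 \<le> l j" for j
    by (rule LIMSEQ_le_const[OF l]) (simp add: q_def)
  have outside: "l j = 0" if "j \<notin> \<Omega>" for j
  proof -
    have "q n j = 0" for n
      using iter_closed[OF z, of n] that by (auto simp: q_def pmf_eq_0_set_pmf)
    with l[of j] show ?thesis by (simp add: LIMSEQ_const_iff)
  qed
  have sum1: "(\<Sum>j\<in>\<Omega>. l j) = 1"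
  proof -
    have "(\<Sum>j\<in>\<Omega>. q n j) = 1" for n
      unfolding q_def by (rule sum_pmf_eq_1) (use finite_states iter_closed[OF z] in auto)
    moreover have "(\<lambda>n. \<Sum>j\<in>\<Omega>. q n j) \<longlonglongrightarrow> (\<Sum>j\<in>\<Omega>. l j)"
      by (intro tendsto_sum l)
    ultimately show ?thesis by (simp add: LIMSEQ_const_iff)
  qed
  have nn1: "(\<integral>\<^sup>+x. ennreal (l x) \<partial>count_space UNIV) = 1"
    by (subst nn_integral_count_space'[of \<Omega>])
       (use finite_states outside nonneg sum1 in \<open>auto simp: sum_ennreal\<close>)
  define d where "d = embed_pmf l"
  have pmf_d: "pmf d j = l j" for j
    unfolding d_def using nonneg nn1 by (rule pmf_embed_pmf)
  have d: "set_pmf d \<subseteq> \<Omega>"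
    using outside pmf_d by (auto simp: set_pmf_eq)
  have "bind_pmf d K = d"
  proof (rule pmf_eqI)
    fix j
    have *: "pmf (bind_pmf D K) j = (\<Sum>i\<in>\<Omega>. pmf D i * pmf (K i) j)" if "set_pmf D \<subseteq> \<Omega>" for D
      using that finite_states by (subst pmf_bind, subst integral_measure_pmf[of \<Omega>]) auto
    have "q (Suc n) j = (\<Sum>i\<in>\<Omega>. q n i * pmf (K i) j)" for n
      using *[OF iter_closed[OF z]] by (simp add: q_def)
    moreover have "(\<lambda>n. \<Sum>i\<in>\<Omega>. q n i * pmf (K i) j) \<longlonglongrightarrow> (\<Sum>i\<in>\<Omega>. l i * pmf (K i) j)"
      by (intro tendsto_sum tendsto_mult l tendsto_const)
    ultimately have "(\<lambda>n. q (Suc n) j) \<longlonglongrightarrow> (\<Sum>i\<in>\<Omega>. l i * pmf (K i) j)" by simp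
    moreover have "(\<lambda>n. q (Suc n) j) \<longlonglongrightarrow> l j"
      using l by (rule LIMSEQ_Suc)
    ultimately show "pmf (bind_pmf d K) j = pmf d j"
      using LIMSEQ_unique *[OF d] by (auto simp: pmf_d)
  qed
  with d show ?thesis by blast
qed

lemma stationary_distribution_is_stationary:
  "set_pmf (stationary_distribution \<Omega> K) \<subseteq> \<Omega>"
  "bind_pmf (stationary_distribution \<Omega> K) K = stationary_distribution \<Omega> K"
proof -
  have "\<exists>!d. set_pmf d \<subseteq> \<Omega> \<and> bind_pmf d K = d"
    using stationary_exists stationary_unique by blast
  from theI'[OF this] show
    "set_pmf (stationary_distribution \<Omega> K) \<subseteq> \<Omega>"
    "bind_pmf (stationary_distribution \<Omega> K) K = stationary_distribution \<Omega> K"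
    unfolding stationary_distribution_def by auto
qed

lemma expectation_iter_stationary_diff:
  fixes f :: "'s \<Rightarrow> real"
  assumes f: "\<And>x. x \<in> \<Omega> \<Longrightarrow> 0 \<le> f x \<and> f x \<le> 1" and x: "x \<in> \<Omega>"
  shows "\<bar>measure_pmf.expectation (iter_pmf K n x) f -
          measure_pmf.expectation (stationary_distribution \<Omega> K) f\<bar> \<le> rate ^ n"
  using expectation_bind_iter_diff[OF f, where d = "return_pmf x" and d' = "stationary_distribution \<Omega> K" and n = n]
    stationary_distribution_is_stationary x
  by (simp add: bind_return_pmf stationary_bind_iter_pmf)

end

section \<open>Monotonicity and symmetry of the binomial distribution\<close>

lemma expectation_binomial_Suc:
  fixes h :: "nat \<Rightarrow> real"
  assumes q: "q \<in> {0..1}"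
  shows "measure_pmf.expectation (binomial_pmf (Suc n) q) h =
    q * measure_pmf.expectation (binomial_pmf n q) (\<lambda>k. h (Suc k)) +
    (1 - q) * measure_pmf.expectation (binomial_pmf n q) h"
proof -
  have fin: "finite (set_pmf (binomial_pmf n q))"
    using q by (rule finite_set_pmf_binomial_pmf)
  show ?thesis
    using q fin unfolding binomial_pmf_Suc[OF q]
    by (simp add: expectation_bind_pmf_finite)
qed

lemma mono_expectation_binomial:
  fixes h :: "nat \<Rightarrow> real"
  assumes q: "q \<in> {0..1}" and h: "mono h"
  shows "mono (\<lambda>n. measure_pmf.expectation (binomial_pmf n q) h)"
proof (rule mono_iff_le_Suc[THEN iffD2], rule allI)
  fix n
  have "measure_pmf.expectation (binomial_pmf n q) h \<le> measure_pmf.expectation (binomial_pmf n q) (\<lambda>k. h (Suc k))"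
    by (rule expectation_pmf_mono) (use q monoD[OF h] in auto)
  hence "q * measure_pmf.expectation (binomial_pmf n q) h
      \<le> q * measure_pmf.expectation (binomial_pmf n q) (\<lambda>k. h (Suc k))"
    using q by (intro mult_left_mono) auto
  thus "measure_pmf.expectation (binomial_pmf n q) h \<le> measure_pmf.expectation (binomial_pmf (Suc n) q) h"
    unfolding expectation_binomial_Suc[OF q] by (simp add: algebra_simps)
qed

lemma map_pmf_diff_binomial:
  assumes p: "0 \<le> p" "p \<le> 1"
  shows "map_pmf (\<lambda>k. n - k) (binomial_pmf n p) = binomial_pmf n (1 - p)"
proof (rule pmf_eqI)
  fix k
  have sub: "set_pmf (binomial_pmf n p) \<subseteq> {..n}"
    using p by (auto simp: set_pmf_binomial_eq)
  show "pmf (map_pmf (\<lambda>k. n - k) (binomial_pmf n p)) k = pmf (binomial_pmf n (1 - p)) k"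
  proof (cases "k \<le> n")
    case True
    have "pmf (map_pmf (\<lambda>k. n - k) (binomial_pmf n p)) k
        = measure_pmf.prob (binomial_pmf n p) ((\<lambda>k. n - k) -` {k})"
      by (simp add: pmf_map)
    also have "\<dots> = measure_pmf.prob (binomial_pmf n p) {n - k}"
      by (rule measure_pmf.finite_measure_eq_AE) (use sub True in \<open>auto intro!: AE_pmfI\<close>)
    also have "\<dots> = pmf (binomial_pmf n (1 - p)) k"
      using p True by (simp add: measure_pmf_single binomial_symmetric[of k n])
    finally show ?thesis .
  next
    case False
    thus ?thesis using p by (subst pmf_map_outside) auto
  qed
qed

section \<open>Entanglement levels within a slot\<close>

context
  fixes G :: "'v switch"
  assumes G: "valid_switch G"
begin

lemma finite_nodes: "finite (nodes G)"
  and edge_subset: "e \<in> edges G \<Longrightarrow> e \<subseteq> nodes G"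
  and card_edge: "e \<in> edges G \<Longrightarrow> card e = 2"
  and gen_prob_bounds: "v \<in> nodes G \<Longrightarrow> 0 < gen_prob G v" "v \<in> nodes G \<Longrightarrow> gen_prob G v < 1"
  and loss_prob_bounds: "v \<in> nodes G \<Longrightarrow> 0 < loss_prob G v" "v \<in> nodes G \<Longrightarrow> loss_prob G v < 1"
  using G by (auto simp: valid_switch_def)

lemma finite_edges: "finite (edges G)"
  by (rule finite_subset[of _ "Pow (nodes G)"]) (use edge_subset finite_nodes in auto)

lemma finite_matchings: "finite (matchings G)"
  by (rule finite_subset[of _ "Pow (edges G)"]) (use finite_edges in \<open>auto simp: matchings_def\<close>)

lemma incident_subset: "incident G v \<subseteq> edges G"
  by (auto simp: incident_def)

lemma finite_incident: "finite (incident G v)"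
  using finite_subset[OF incident_subset finite_edges] .

lemma finite_scheduler: "set_pmf p \<subseteq> matchings G \<Longrightarrow> finite (set_pmf p)"
  using finite_matchings finite_subset by blast

lemma incident_outside: "v \<notin> nodes G \<Longrightarrow> incident G v = {}"
  using edge_subset by (auto simp: incident_def)

text \<open>
  A matching has at most one edge at \<open>v\<close>, hence at most one service.
\<close>

lemma sum_services_le_covered:
  assumes M: "M \<in> matchings G" and S: "\<And>e. S e \<le> (of_bool (e \<in> M) :: nat)"
  shows "(\<Sum>e\<in>incident G v. S e) \<le> of_bool (\<exists>e\<in>M. v \<in> e)"
proof (cases "\<exists>e\<in>M. v \<in> e")
  case False
  hence "S e = 0" if "e \<in> incident G v" for e
    using S[of e] that by (auto simp: incident_def)
  thus ?thesis by simp
next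
  case True
  then obtain e0 where e0: "e0 \<in> M" "v \<in> e0" by blast
  have "e = e0" if "e \<in> M" "v \<in> e" for e
    using M e0 that by (auto simp: matchings_def pairwise_def disjnt_def)
  hence "S e \<le> of_bool (e = e0)" if "e \<in> incident G v" for e
    using S[of e] that by (cases "e \<in> M") (auto simp: incident_def)
  hence "(\<Sum>e\<in>incident G v. S e) \<le> (\<Sum>e\<in>incident G v. of_bool (e = e0))"
    by (rule sum_mono)
  also have "\<dots> \<le> 1"
    using finite_incident by (simp add: of_bool_def sum.delta)
  finally show ?thesis using True by simp
qed

text \<open>
  The law of the level of node \<open>u\<close> at the end of a slot if \<open>n\<close> entanglements remain after
  service. As in the reference chain, the binomial variable counts the survivors, not the losses.
\<close>

definition refill :: "'v \<Rightarrow> nat \<Rightarrow> nat pmf" where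
  "refill u n = do {
     A \<leftarrow> bernoulli_pmf (gen_prob G u);
     K \<leftarrow> binomial_pmf n (1 - loss_prob G u);
     return_pmf (min (buf G u) (K + of_bool A))
   }"

lemma reference_step_refill:
  "reference_step G u i = bind_pmf (bernoulli_pmf (2/3 * gen_prob G u)) (\<lambda>S. refill u (i - of_bool S))"
  by (simp add: reference_step_def refill_def)

lemma finite_refill: "u \<in> nodes G \<Longrightarrow> finite (set_pmf (refill u n))"
  using loss_prob_bounds[of u] by (auto simp: refill_def)

lemma expectation_refill:
  fixes f :: "nat \<Rightarrow> real"
  assumes u: "u \<in> nodes G"
  shows "measure_pmf.expectation (refill u n) f =
    gen_prob G u * measure_pmf.expectation (binomial_pmf n (1 - loss_prob G u)) (\<lambda>k. f (min (buf G u) (Suc k))) +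
    (1 - gen_prob G u) * measure_pmf.expectation (binomial_pmf n (1 - loss_prob G u)) (\<lambda>k. f (min (buf G u) k))"
proof -
  have fin: "finite (set_pmf (binomial_pmf n (1 - loss_prob G u)))"
    using loss_prob_bounds[OF u] by (intro finite_set_pmf_binomial_pmf) auto
  show ?thesis
    unfolding refill_def using gen_prob_bounds[OF u] fin
    by (simp add: expectation_bind_pmf_finite)
qed

lemma mono_refill:
  fixes f :: "nat \<Rightarrow> real"
  assumes u: "u \<in> nodes G" and f: "mono f"
  shows "mono (\<lambda>n. measure_pmf.expectation (refill u n) f)"
proof -
  have "mono (\<lambda>n. measure_pmf.expectation (binomial_pmf n (1 - loss_prob G u)) (\<lambda>k. f (min (buf G u) (k + a))))" for a
    using loss_prob_bounds[OF u] by (intro mono_expectation_binomial) (auto intro!: monoI monoD[OF f])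
  from this[of 0] this[of 1] show ?thesis
    using gen_prob_bounds[OF u] unfolding expectation_refill[OF u]
    by (auto intro!: monoI add_mono mult_left_mono dest: monoD)
qed

lemma expectation_refill_le:
  assumes u: "u \<in> nodes G"
  shows "measure_pmf.expectation (refill u n) real \<le> real n + gen_prob G u"
proof -
  let ?B = "binomial_pmf n (1 - loss_prob G u)"
  have fin: "finite (set_pmf ?B)" and sub: "set_pmf ?B \<subseteq> {..n}"
    using loss_prob_bounds[OF u] by auto
  have "measure_pmf.expectation ?B (\<lambda>k. real (min (buf G u) (Suc k))) \<le> real n + 1"
    using sub by (intro expectation_pmf_bounds(2)[OF fin, of 0]) auto
  moreover have "measure_pmf.expectation ?B (\<lambda>k. real (min (buf G u) k)) \<le> real n"
    using sub by (intro expectation_pmf_bounds(2)[OF fin, of 0]) auto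
  ultimately have "measure_pmf.expectation (refill u n) real
      \<le> gen_prob G u * (real n + 1) + (1 - gen_prob G u) * real n"
    unfolding expectation_refill[OF u] using gen_prob_bounds[OF u]
    by (intro add_mono mult_left_mono) auto
  thus ?thesis by (simp add: algebra_simps)
qed

text \<open>
  The empty buffer is reached in one step: all entanglements decohere and none is generated.
\<close>

lemma reference_doeblin:
  assumes u: "u \<in> nodes G"
  shows "doeblin_chain {0..buf G u} (reference_step G u) 0"
proof
  fix i
  show "set_pmf (reference_step G u i) \<subseteq> {0..buf G u}"
    by (auto simp: reference_step_def)
  have "0 \<in> set_pmf (binomial_pmf m (1 - loss_prob G u))" for m
    using loss_prob_bounds[OF u] by simp
  moreover have "False \<in> set_pmf (bernoulli_pmf (gen_prob G u))"
    using gen_prob_bounds[OF u] by (simp add: set_pmf_iff)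
  moreover have "set_pmf (bernoulli_pmf (2/3 * gen_prob G u)) \<noteq> {}"
    by (rule set_pmf_not_empty)
  ultimately show "0 \<in> set_pmf (reference_step G u i)"
    unfolding reference_step_def set_bind_pmf UN_iff
    by (metis all_not_in_conv add_0 min_0R of_bool_eq(1) set_return_pmf singletonI)
qed auto

lemma entanglement_step_component:
  assumes u: "u \<in> nodes G"
  shows "map_pmf (\<lambda>L'. L' u) (entanglement_step G S L) = refill u (L u - (\<Sum>e\<in>incident G u. S e))"
proof -
  let ?n = "L u - (\<Sum>e\<in>incident G u. S e)"
  let ?PD = "Pi_pmf (nodes G) 0 (\<lambda>v. binomial_pmf (L v - (\<Sum>e\<in>incident G v. S e)) (loss_prob G v))"
  let ?PY = "Pi_pmf (nodes G) False (\<lambda>v. bernoulli_pmf (gen_prob G v))"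
  have D: "map_pmf (\<lambda>D. D u) ?PD = binomial_pmf ?n (loss_prob G u)"
    using u by (simp add: Pi_pmf_component finite_nodes)
  have Y: "map_pmf (\<lambda>Y. Y u) ?PY = bernoulli_pmf (gen_prob G u)"
    using u by (simp add: Pi_pmf_component finite_nodes)
  have "map_pmf (\<lambda>L'. L' u) (entanglement_step G S L)
      = bind_pmf ?PD (\<lambda>D. bind_pmf ?PY (\<lambda>Y. return_pmf (min (buf G u) (?n - D u + of_bool (Y u)))))"
    by (simp add: entanglement_step_def map_bind_pmf)
  also have "\<dots> = bind_pmf (map_pmf (\<lambda>D. ?n - D u) ?PD) (\<lambda>k. bind_pmf (map_pmf (\<lambda>Y. Y u) ?PY)
      (\<lambda>y. return_pmf (min (buf G u) (k + of_bool y))))"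
    by (simp add: bind_map_pmf)
  also have "map_pmf (\<lambda>D. ?n - D u) ?PD = map_pmf (\<lambda>k. ?n - k) (map_pmf (\<lambda>D. D u) ?PD)"
    by (simp add: pmf.map_comp o_def)
  also have "\<dots> = binomial_pmf ?n (1 - loss_prob G u)"
    unfolding D using loss_prob_bounds[OF u] by (intro map_pmf_diff_binomial) auto
  also have "bind_pmf (binomial_pmf ?n (1 - loss_prob G u)) (\<lambda>k. bind_pmf (map_pmf (\<lambda>Y. Y u) ?PY)
      (\<lambda>y. return_pmf (min (buf G u) (k + of_bool y)))) = refill u ?n"
    unfolding Y refill_def by (rule bind_commute_pmf)
  finally show ?thesis .
qed

lemma finite_ent_states: "finite (ent_states G)"
  unfolding ent_states_def by (intro finite_PiE_dflt finite_nodes) auto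

lemma set_entanglement_step:
  assumes "L \<in> ent_states G"
  shows "set_pmf (entanglement_step G S L) \<subseteq> ent_states G"
proof -
  have "min (buf G v) (L v - (\<Sum>e\<in>incident G v. S e) - D v + of_bool (Y v)) = 0"
    if "v \<notin> nodes G" "Y \<in> set_pmf (Pi_pmf (nodes G) False (\<lambda>v. bernoulli_pmf (gen_prob G v)))" for v D Y
    using that assms set_Pi_pmf_subset[OF finite_nodes, of False "\<lambda>v. bernoulli_pmf (gen_prob G v)"]
    by (auto simp: incident_outside ent_states_def PiE_dflt_def)
  thus ?thesis
    by (auto simp: entanglement_step_def ent_states_def PiE_dflt_def)
qed

lemma zero_in_entanglement_step:
  assumes L: "L \<in> ent_states G"
  shows "(\<lambda>_. 0) \<in> set_pmf (entanglement_step G S L)"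
proof -
  let ?n = "\<lambda>v. L v - (\<Sum>e\<in>incident G v. S e)"
  let ?D = "\<lambda>v. if v \<in> nodes G then ?n v else 0"
  have D: "?D \<in> set_pmf (Pi_pmf (nodes G) 0 (\<lambda>v. binomial_pmf (?n v) (loss_prob G v)))"
    using loss_prob_bounds by (auto simp: set_Pi_pmf finite_nodes PiE_dflt_def)
  have Y: "(\<lambda>_. False) \<in> set_pmf (Pi_pmf (nodes G) False (\<lambda>v. bernoulli_pmf (gen_prob G v)))"
    using gen_prob_bounds by (auto simp: set_Pi_pmf finite_nodes PiE_dflt_def set_pmf_iff)
  have "(\<lambda>v. min (buf G v) (?n v - ?D v + of_bool False)) = (\<lambda>_. 0)"
    using L by (auto simp: fun_eq_iff ent_states_def PiE_dflt_def)
  thus ?thesis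
    unfolding entanglement_step_def set_bind_pmf UN_iff set_return_pmf
    by (intro bexI[OF _ D] bexI[OF _ Y]) simp
qed

section \<open>Request-agnostic policies and the LP\<close>

lemma agnostic_doeblin:
  assumes \<pi>: "agnostic_policy G \<pi>"
  shows "doeblin_chain (ent_states G) (agnostic_step G \<pi>) (\<lambda>_. 0)"
proof
  fix L assume L: "L \<in> ent_states G"
  show "set_pmf (agnostic_step G \<pi> L) \<subseteq> ent_states G"
    using set_entanglement_step[OF L] by (auto simp: agnostic_step_def)
  show "(\<lambda>_. 0) \<in> set_pmf (agnostic_step G \<pi> L)"
    using zero_in_entanglement_step[OF L] set_pmf_not_empty[of "\<pi> L"] by (auto simp: agnostic_step_def)
qed (auto simp: finite_ent_states, auto simp: ent_states_def PiE_dflt_def)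

lemma agnostic_service_sum_le:
  assumes "M \<in> matchings G"
  shows "(\<Sum>e\<in>incident G v. agnostic_service M L e) \<le> L v"
proof (cases "L v = 0")
  case True
  hence "agnostic_service M L e = 0" if "e \<in> incident G v" for e
    using that by (force simp: agnostic_service_def incident_def)
  thus ?thesis by simp
next
  case False
  have "(\<Sum>e\<in>incident G v. agnostic_service M L e) \<le> of_bool (\<exists>e\<in>M. v \<in> e)"
    by (rule sum_services_le_covered) (auto simp: assms agnostic_service_def)
  also have "\<dots> \<le> L v" using False by simp
  finally show ?thesis .
qed

lemma agnostic_step_drift:
  assumes M: "set_pmf (\<pi> L) \<subseteq> matchings G" and v: "v \<in> nodes G"
  shows "measure_pmf.expectation (agnostic_step G \<pi> L) (\<lambda>L'. real (L' v)) \<le>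
    real (L v) + gen_prob G v -
    (\<Sum>e\<in>incident G v. measure_pmf.expectation (\<pi> L) (\<lambda>M. real (agnostic_service M L e)))"
proof -
  have fin: "finite (set_pmf (\<pi> L))" by (rule finite_scheduler[OF M])
  let ?s = "\<lambda>M. \<Sum>e\<in>incident G v. agnostic_service M L e"
  have "map_pmf (\<lambda>L'. L' v) (agnostic_step G \<pi> L) = bind_pmf (\<pi> L) (\<lambda>M. refill v (L v - ?s M))"
    by (simp add: agnostic_step_def map_bind_pmf entanglement_step_component[OF v])
  hence "measure_pmf.expectation (agnostic_step G \<pi> L) (\<lambda>L'. real (L' v)) =
      measure_pmf.expectation (bind_pmf (\<pi> L) (\<lambda>M. refill v (L v - ?s M))) real"
    by (metis integral_map_pmf)
  also have "\<dots> = measure_pmf.expectation (\<pi> L) (\<lambda>M. measure_pmf.expectation (refill v (L v - ?s M)) real)"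
    by (rule expectation_bind_pmf_finite) (use fin finite_refill[OF v] in auto)
  also have "\<dots> \<le> measure_pmf.expectation (\<pi> L)
      (\<lambda>M. real (L v) + gen_prob G v - (\<Sum>e\<in>incident G v. real (agnostic_service M L e)))"
  proof (rule expectation_pmf_mono)
    fix N assume "N \<in> set_pmf (\<pi> L)"
    hence "?s N \<le> L v" using agnostic_service_sum_le M by blast
    thus "measure_pmf.expectation (refill v (L v - ?s N)) real \<le>
        real (L v) + gen_prob G v - (\<Sum>e\<in>incident G v. real (agnostic_service N L e))"
      using expectation_refill_le[OF v, of "L v - ?s N"] by (simp add: of_nat_diff)
  qed (use fin in \<open>auto intro: integrable_measure_pmf_finite\<close>)
  also have "\<dots> = real (L v) + gen_prob G v -
    (\<Sum>e\<in>incident G v. measure_pmf.expectation (\<pi> L) (\<lambda>M. real (agnostic_service M L e)))"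
    using fin by (simp add: integrable_measure_pmf_finite Bochner_Integration.integral_diff
        Bochner_Integration.integral_sum)
  finally show ?thesis .
qed

lemma expectation_agnostic_service:
  assumes M: "set_pmf (\<pi> L) \<subseteq> matchings G"
  shows "measure_pmf.expectation (\<pi> L) (\<lambda>M. real (agnostic_service M L e)) =
    (if \<forall>v\<in>e. 0 < L v then \<Sum>M\<in>{M \<in> matchings G. e \<in> M}. pmf (\<pi> L) M else 0)"
proof -
  have "measure_pmf.expectation (\<pi> L) (\<lambda>M. real (agnostic_service M L e)) =
      (\<Sum>M\<in>matchings G. pmf (\<pi> L) M * real (agnostic_service M L e))"
    by (subst integral_measure_pmf[of "matchings G"]) (use finite_matchings M in auto)
  also have "\<dots> = (if \<forall>v\<in>e. 0 < L v then \<Sum>M\<in>{M \<in> matchings G. e \<in> M}. pmf (\<pi> L) M else 0)"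
  proof (cases "\<forall>v\<in>e. 0 < L v")
    case True
    hence "(\<Sum>M\<in>matchings G. pmf (\<pi> L) M * real (agnostic_service M L e))
        = (\<Sum>M\<in>matchings G. if e \<in> M then pmf (\<pi> L) M else 0)"
      by (intro sum.cong) (auto simp: agnostic_service_def)
    thus ?thesis using True finite_matchings by (simp add: sum.inter_filter)
  next
    case False
    hence "agnostic_service M L e = 0" for M by (auto simp: agnostic_service_def)
    thus ?thesis using False by (simp only: if_False) simp
  qed
  finally show ?thesis .
qed

text \<open>
  In stationarity the mean level of node \<open>v\<close> is constant, so the rate at which entanglements are
  consumed at \<open>v\<close> is at most the rate \<open>\<lambda>\<^sub>v\<close> at which they are generated.
\<close>

lemma agnostic_rates_lp_feasible:
  assumes \<pi>: "agnostic_policy G \<pi>"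
  defines "d \<equiv> stationary_distribution (ent_states G) (agnostic_step G \<pi>)"
  shows "lp_feasible G (\<lambda>e. \<Sum>L\<in>{L \<in> ent_states G. \<forall>v\<in>e. 0 < L v}.
      \<Sum>M\<in>{M \<in> matchings G. e \<in> M}. pmf (\<pi> L) M * pmf d L)"
proof -
  interpret doeblin_chain "ent_states G" "agnostic_step G \<pi>" "\<lambda>_. 0"
    by (rule agnostic_doeblin[OF \<pi>])
  have d: "set_pmf d \<subseteq> ent_states G" "bind_pmf d (agnostic_step G \<pi>) = d"
    using stationary_distribution_is_stationary by (auto simp: d_def)
  have fd: "finite (set_pmf d)" using d(1) finite_states finite_subset by blast
  have M: "set_pmf (\<pi> L) \<subseteq> matchings G" if "L \<in> ent_states G" for L
    using \<pi> that by (auto simp: agnostic_policy_def)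
  let ?q = "\<lambda>L e. measure_pmf.expectation (\<pi> L) (\<lambda>M. real (agnostic_service M L e))"
  define y where "y = (\<lambda>e. measure_pmf.expectation d (\<lambda>L. ?q L e))"
  have y: "(\<Sum>L\<in>{L \<in> ent_states G. \<forall>v\<in>e. 0 < L v}.
      \<Sum>M\<in>{M \<in> matchings G. e \<in> M}. pmf (\<pi> L) M * pmf d L) = y e" for e
  proof -
    have "y e = (\<Sum>L\<in>ent_states G. pmf d L * ?q L e)"
      unfolding y_def by (subst integral_measure_pmf[of "ent_states G"]) (use finite_states d in auto)
    also have "\<dots> = (\<Sum>L\<in>ent_states G. if \<forall>v\<in>e. 0 < L v then
        \<Sum>M\<in>{M \<in> matchings G. e \<in> M}. pmf (\<pi> L) M * pmf d L else 0)"
      by (rule sum.cong)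
         (auto simp: expectation_agnostic_service[where \<pi> = \<pi>, OF M] sum_distrib_left mult.commute)
    finally show ?thesis using finite_states by (simp add: sum.inter_filter)
  qed
  have "(\<Sum>e\<in>incident G v. y e) \<le> gen_prob G v" if v: "v \<in> nodes G" for v
  proof -
    have "measure_pmf.expectation d (\<lambda>L. real (L v)) =
        measure_pmf.expectation (bind_pmf d (agnostic_step G \<pi>)) (\<lambda>L. real (L v))"
      by (simp add: d)
    also have "\<dots> = measure_pmf.expectation d
        (\<lambda>L. measure_pmf.expectation (agnostic_step G \<pi> L) (\<lambda>L. real (L v)))"
      by (rule expectation_bind_pmf_finite) (use fd finite_K d in auto)
    also have "\<dots> \<le> measure_pmf.expectation d
        (\<lambda>L. real (L v) + gen_prob G v - (\<Sum>e\<in>incident G v. ?q L e))"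
      by (rule expectation_pmf_mono)
         (use fd d agnostic_step_drift[where \<pi> = \<pi>, OF M v] in \<open>auto intro!: integrable_measure_pmf_finite\<close>)
    also have "\<dots> = measure_pmf.expectation d (\<lambda>L. real (L v)) + gen_prob G v - (\<Sum>e\<in>incident G v. y e)"
      unfolding y_def
      using fd by (simp add: integrable_measure_pmf_finite Bochner_Integration.integral_diff
        Bochner_Integration.integral_sum)
    finally show ?thesis by simp
  qed
  moreover have "0 \<le> y e" for e unfolding y_def by simp
  ultimately show ?thesis unfolding lp_feasible_def y by blast
qed

end

section \<open>Comparison with the reference chain\<close>

lemma
  fixes f :: "nat \<Rightarrow> real"
  assumes G: "valid_switch G" and u: "u \<in> nodes G" and f: "mono f"
  shows mono_reference_step: "mono (\<lambda>i. measure_pmf.expectation (reference_step G u i) f)"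
    and expectation_reference_step: "measure_pmf.expectation (reference_step G u i) f =
      2/3 * gen_prob G u * measure_pmf.expectation (refill G u (i - 1)) f +
      (1 - 2/3 * gen_prob G u) * measure_pmf.expectation (refill G u i) f"
proof -
  have g: "0 < gen_prob G u" "gen_prob G u < 1" using gen_prob_bounds[OF G u] by auto
  have eq: "measure_pmf.expectation (reference_step G u i) f =
      2/3 * gen_prob G u * measure_pmf.expectation (refill G u (i - 1)) f +
      (1 - 2/3 * gen_prob G u) * measure_pmf.expectation (refill G u i) f" for i
    unfolding reference_step_refill[OF G] using g finite_refill[OF G u]
    by (simp add: expectation_bind_pmf_finite)
  thus "measure_pmf.expectation (reference_step G u i) f =
      2/3 * gen_prob G u * measure_pmf.expectation (refill G u (i - 1)) f +
      (1 - 2/3 * gen_prob G u) * measure_pmf.expectation (refill G u i) f" .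
  show "mono (\<lambda>i. measure_pmf.expectation (reference_step G u i) f)"
    unfolding eq
    by (intro monoI add_mono mult_left_mono monoD[OF mono_refill[OF G u f]]) (use g in auto)
qed

lemma slot_entanglement_component:
  assumes G: "valid_switch G" and u: "u \<in> nodes G"
  shows "map_pmf (\<lambda>Y. fst Y u) (slot G arr p (L, R)) =
    bind_pmf p (\<lambda>M. refill G u (L u - (\<Sum>e\<in>incident G u. service M L R e)))"
proof -
  have "map_pmf (\<lambda>Y. fst Y u) (slot G arr p (L, R)) =
      bind_pmf p (\<lambda>M. map_pmf (\<lambda>L'. L' u) (entanglement_step G (service M L R) L))"
    by (simp add: slot_def map_bind_pmf Let_def map_pmf_def bind_assoc_pmf bind_return_pmf)
  thus ?thesis by (simp add: entanglement_step_component[OF G u])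
qed

text \<open>
  One slot of the switch, seen at node \<open>u\<close>, stochastically dominates a step of the reference
  chain. A service at \<open>u\<close> requires that the matching covers \<open>u\<close>; this event is independent of
  the state and has probability at most \<open>2/3 \<lambda>\<^sub>u\<close>, whereas the reference chain attempts a
  service with exactly that probability.
\<close>

lemma slot_dominates_reference:
  fixes f :: "nat \<Rightarrow> real"
  assumes G: "valid_switch G" and u: "u \<in> nodes G" and p: "set_pmf p \<subseteq> matchings G"
    and cover: "(\<Sum>e\<in>incident G u. measure_pmf.prob p {M. e \<in> M}) \<le> 2/3 * gen_prob G u"
    and f: "mono f"
  shows "measure_pmf.expectation (reference_step G u (fst X u)) f
    \<le> measure_pmf.expectation (slot G arr p X) (\<lambda>Y. f (fst Y u))"
proof -
  obtain L R where X: "X = (L, R)" by fastforce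
  let ?s = "\<lambda>M. \<Sum>e\<in>incident G u. service M L R e"
  let ?g = "\<lambda>n. measure_pmf.expectation (refill G u n) f"
  let ?C = "{M. \<exists>e\<in>M. u \<in> e}"
  have fin: "finite (set_pmf p)" by (rule finite_scheduler[OF G p])
  have mono: "mono ?g" by (rule mono_refill[OF G u f])
  have "measure_pmf.prob p ?C = measure_pmf.prob p (\<Union>e\<in>incident G u. {M. e \<in> M})"
    by (rule measure_pmf.finite_measure_eq_AE)
       (use p in \<open>auto intro!: AE_pmfI simp: incident_def matchings_def\<close>)
  also have "\<dots> \<le> (\<Sum>e\<in>incident G u. measure_pmf.prob p {M. e \<in> M})"
    by (rule measure_pmf.finite_measure_subadditive_finite) (auto simp: finite_incident[OF G])
  finally have cov: "measure_pmf.prob p ?C \<le> 2/3 * gen_prob G u"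
    using cover by simp
  have "measure_pmf.expectation (reference_step G u (L u)) f =
      ?g (L u) - 2/3 * gen_prob G u * (?g (L u) - ?g (L u - 1))"
    unfolding expectation_reference_step[OF G u f] by (simp add: algebra_simps)
  also have "\<dots> \<le> ?g (L u) - measure_pmf.prob p ?C * (?g (L u) - ?g (L u - 1))"
    using mult_right_mono[OF cov, of "?g (L u) - ?g (L u - 1)"] monoD[OF mono, of "L u - 1" "L u"]
    by simp
  also have "\<dots> = measure_pmf.expectation p (\<lambda>M. ?g (L u) - indicator ?C M * (?g (L u) - ?g (L u - 1)))"
    using fin by (simp add: integrable_measure_pmf_finite Bochner_Integration.integral_diff)
  also have "\<dots> \<le> measure_pmf.expectation p (\<lambda>M. ?g (L u - ?s M))"
  proof (rule expectation_pmf_mono)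
    fix M assume "M \<in> set_pmf p"
    hence "?s M \<le> of_bool (\<exists>e\<in>M. u \<in> e)"
      using p by (intro sum_services_le_covered[OF G]) (auto simp: service_def)
    hence "?g (L u - of_bool (\<exists>e\<in>M. u \<in> e)) \<le> ?g (L u - ?s M)"
      by (intro monoD[OF mono] diff_le_mono2)
    thus "?g (L u) - indicator ?C M * (?g (L u) - ?g (L u - 1)) \<le> ?g (L u - ?s M)"
      by (cases "\<exists>e\<in>M. u \<in> e") (auto simp: indicator_def)
  qed (use fin in \<open>auto intro: integrable_measure_pmf_finite\<close>)
  also have "\<dots> = measure_pmf.expectation (bind_pmf p (\<lambda>M. refill G u (L u - ?s M))) f"
    by (rule expectation_bind_pmf_finite[symmetric]) (use fin finite_refill[OF G u] in auto)
  also have "\<dots> = measure_pmf.expectation (slot G arr p (L, R)) (\<lambda>Y. f (fst Y u))"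
    by (simp flip: slot_entanglement_component[OF G u, of arr p L R])
  finally show ?thesis by (simp add: X)
qed

text \<open>
  Domination persists over several slots because the reference kernel preserves monotone
  functions.
\<close>

lemma frame_dominates_reference:
  fixes f :: "nat \<Rightarrow> real"
  assumes G: "valid_switch G" and u: "u \<in> nodes G" and p: "set_pmf p \<subseteq> matchings G"
    and cover: "(\<Sum>e\<in>incident G u. measure_pmf.prob p {M. e \<in> M}) \<le> 2/3 * gen_prob G u"
    and f: "mono f" "\<And>n. \<bar>f n\<bar> \<le> B"
  shows "measure_pmf.expectation (iter_pmf (reference_step G u) m (fst X u)) f
    \<le> measure_pmf.expectation (iter_pmf (slot G arr p) m X) (\<lambda>Y. f (fst Y u))"
  using f
proof (induction m arbitrary: f)
  case 0
  thus ?case by simp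
next
  case (Suc m)
  define Qf where "Qf = (\<lambda>i. measure_pmf.expectation (reference_step G u i) f)"
  have Qf: "mono Qf" "\<And>n. \<bar>Qf n\<bar> \<le> B"
    unfolding Qf_def using mono_reference_step[OF G u Suc.prems(1)] abs_expectation_pmf_le[of f B] Suc.prems(2)
    by auto
  have "measure_pmf.expectation (iter_pmf (reference_step G u) (Suc m) (fst X u)) f
      = measure_pmf.expectation (iter_pmf (reference_step G u) m (fst X u)) Qf"
    unfolding iter_pmf.simps Qf_def by (rule expectation_bind_pmf_bounded) (rule Suc.prems)
  also have "\<dots> \<le> measure_pmf.expectation (iter_pmf (slot G arr p) m X) (\<lambda>Y. Qf (fst Y u))"
    by (rule Suc.IH) (rule Qf)+
  also have "\<dots> \<le> measure_pmf.expectation (iter_pmf (slot G arr p) m X)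
      (\<lambda>Y. measure_pmf.expectation (slot G arr p Y) (\<lambda>Y. f (fst Y u)))"
  proof (rule expectation_pmf_mono)
    show "integrable (measure_pmf (iter_pmf (slot G arr p) m X)) (\<lambda>Y. Qf (fst Y u))"
      by (rule integrable_pmf_bounded) (rule Qf)
    show "integrable (measure_pmf (iter_pmf (slot G arr p) m X))
        (\<lambda>Y. measure_pmf.expectation (slot G arr p Y) (\<lambda>Y. f (fst Y u)))"
      by (rule integrable_pmf_bounded, rule abs_expectation_pmf_le) (rule Suc.prems)
    show "Qf (fst Y u) \<le> measure_pmf.expectation (slot G arr p Y) (\<lambda>Y. f (fst Y u))" for Y
      unfolding Qf_def by (rule slot_dominates_reference[OF G u p cover Suc.prems(1)])
  qed
  also have "\<dots> = measure_pmf.expectation (iter_pmf (slot G arr p) (Suc m) X) (\<lambda>Y. f (fst Y u))"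
    unfolding iter_pmf.simps by (rule expectation_bind_pmf_bounded[symmetric]) (rule Suc.prems)
  finally show ?case .
qed

lemma expectation_positive_stationary:
  assumes G: "valid_switch G" and u: "u \<in> nodes G"
  shows "measure_pmf.expectation (stationary_distribution {0..buf G u} (reference_step G u))
      (\<lambda>n. of_bool (0 < n)) = node_coherence G u"
proof -
  let ?d = "stationary_distribution {0..buf G u} (reference_step G u)"
  have "measure_pmf.expectation ?d (\<lambda>n. of_bool (0 < n)) = measure_pmf.expectation ?d (\<lambda>n. 1 - indicator {0} n)"
    by (rule Bochner_Integration.integral_cong) (auto simp: indicator_def)
  also have "\<dots> = 1 - pmf ?d 0"
    by (subst Bochner_Integration.integral_diff)
       (auto simp: measure_pmf_single intro!: integrable_pmf_bounded[where B = 1])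
  finally show ?thesis by (simp add: node_coherence_def)
qed

text \<open>
  The geometric convergence errors are summable, so the expected time with a nonempty buffer
  during \<open>T\<close> steps falls short of its stationary value by at most a constant, independent of \<open>T\<close>
  and of the initial level.
\<close>

lemma reference_occupation_node:
  assumes G: "valid_switch G" and u: "u \<in> nodes G"
  shows "\<exists>H\<ge>0. \<forall>T. \<forall>l\<le>buf G u. real T * node_coherence G u - H
    \<le> (\<Sum>m<T. measure_pmf.expectation (iter_pmf (reference_step G u) m l) (\<lambda>n. of_bool (0 < n)))"
proof -
  interpret doeblin_chain "{0..buf G u}" "reference_step G u" 0
    by (rule reference_doeblin[OF G u])
  show ?thesis
  proof (intro exI[of _ "1 / (1 - rate)"] conjI allI impI)
    fix T l assume l: "l \<le> buf G u"
    have "real T * node_coherence G u - (\<Sum>m<T. rate ^ m) = (\<Sum>m<T. node_coherence G u - rate ^ m)"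
      by (simp add: sum_subtractf)
    also have "\<dots> \<le> (\<Sum>m<T. measure_pmf.expectation (iter_pmf (reference_step G u) m l) (\<lambda>n. of_bool (0 < n)))"
    proof (rule sum_mono)
      fix m
      have "\<bar>measure_pmf.expectation (iter_pmf (reference_step G u) m l) (\<lambda>n. of_bool (0 < n)) -
          node_coherence G u\<bar> \<le> rate ^ m"
        unfolding expectation_positive_stationary[OF G u, symmetric]
        by (rule expectation_iter_stationary_diff) (use l in auto)
      thus "node_coherence G u - rate ^ m
          \<le> measure_pmf.expectation (iter_pmf (reference_step G u) m l) (\<lambda>n. of_bool (0 < n))"
        by linarith
    qed
    finally have "real T * node_coherence G u - (\<Sum>m<T. rate ^ m) \<le> \<dots>" .
    moreover have "(\<Sum>m<T. rate ^ m) \<le> 1 / (1 - rate)"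
    proof -
      have "(\<Sum>m<T. rate ^ m) = (1 - rate ^ T) / (1 - rate)"
        using rate_bounds sum_gp_strict[of rate T] by auto
      also have "\<dots> \<le> 1 / (1 - rate)"
        using rate_bounds by (intro divide_right_mono) auto
      finally show ?thesis .
    qed
    ultimately show "real T * node_coherence G u - 1 / (1 - rate)
      \<le> (\<Sum>m<T. measure_pmf.expectation (iter_pmf (reference_step G u) m l) (\<lambda>n. of_bool (0 < n)))"
      by linarith
  qed (use rate_bounds in auto)
qed

lemma reference_occupation:
  assumes G: "valid_switch G"
  shows "\<exists>H\<ge>0. \<forall>u\<in>nodes G. \<forall>T. \<forall>l\<le>buf G u. real T * node_coherence G u - H
    \<le> (\<Sum>m<T. measure_pmf.expectation (iter_pmf (reference_step G u) m l) (\<lambda>n. of_bool (0 < n)))"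
proof -
  obtain H where H: "\<And>u. u \<in> nodes G \<Longrightarrow> H u \<ge> 0 \<and> (\<forall>T. \<forall>l\<le>buf G u. real T * node_coherence G u - H u
    \<le> (\<Sum>m<T. measure_pmf.expectation (iter_pmf (reference_step G u) m l) (\<lambda>n. of_bool (0 < n))))"
    using reference_occupation_node[OF G] by metis
  have le: "H u \<le> (\<Sum>v\<in>nodes G. H v)" if "u \<in> nodes G" for u
    by (rule member_le_sum) (use H that finite_nodes[OF G] in auto)
  show ?thesis
  proof (intro exI[of _ "\<Sum>v\<in>nodes G. H v"] conjI ballI allI impI)
    show "0 \<le> (\<Sum>v\<in>nodes G. H v)" by (rule sum_nonneg) (use H in auto)
    fix u T l assume "u \<in> nodes G" "l \<le> buf G u"
    with le[of u] H[of u] show "real T * node_coherence G u - (\<Sum>v\<in>nodes G. H v)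
    \<le> (\<Sum>m<T. measure_pmf.expectation (iter_pmf (reference_step G u) m l) (\<lambda>n. of_bool (0 < n)))"
      by (meson diff_left_mono order_trans)
  qed
qed

section \<open>Moments of the request queues\<close>

lemma slot_request_component:
  "map_pmf (\<lambda>Y. snd Y e) (slot G arr p (L, R)) =
    bind_pmf p (\<lambda>M. map_pmf (\<lambda>A. R e - service M L R e + A e) arr)"
  by (simp add: slot_def map_bind_pmf Let_def map_pmf_def bind_assoc_pmf bind_return_pmf)

lemma service_le: "service M L R e \<le> R e" "service M L R e \<le> 1"
  by (auto simp: service_def)

lemma slot_request_mean:
  fixes arr :: "('v set \<Rightarrow> nat) pmf"
  assumes fin: "finite (set_pmf p)"
    and int: "integrable (measure_pmf arr) (\<lambda>a. real (a e))"
  shows "integrable (measure_pmf (slot G arr p X)) (\<lambda>Y. real (snd Y e))"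
    and "measure_pmf.expectation (slot G arr p X) (\<lambda>Y. real (snd Y e)) =
      real (snd X e) - measure_pmf.prob p {M. e \<in> M} * of_bool (0 < snd X e \<and> (\<forall>v\<in>e. 0 < fst X v))
      + measure_pmf.expectation arr (\<lambda>a. real (a e))"
proof -
  obtain L R where X: "X = (L, R)" by fastforce
  let ?D = "bind_pmf p (\<lambda>M. map_pmf (\<lambda>A. R e - service M L R e + A e) arr)"
  let ?\<nu> = "measure_pmf.expectation arr (\<lambda>a. real (a e))"
  have eq: "map_pmf (\<lambda>Y. snd Y e) (slot G arr p X) = ?D"
    unfolding X by (rule slot_request_component)
  have iK: "integrable (measure_pmf (map_pmf (\<lambda>A. R e - service M L R e + A e) arr)) real" for M
    using int by simp
  have EK: "measure_pmf.expectation (map_pmf (\<lambda>A. R e - service M L R e + A e) arr) real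
      = real (R e) - real (service M L R e) + ?\<nu>" for M
    using int service_le(1)[of M L R e] by (simp add: of_nat_diff)
  have iD: "integrable (measure_pmf ?D) real"
    by (rule integrable_bind_pmf_nonneg[where g = "\<lambda>M. real (R e) - real (service M L R e) + ?\<nu>"])
       (use iK EK fin in \<open>auto intro: integrable_measure_pmf_finite\<close>)
  show "integrable (measure_pmf (slot G arr p X)) (\<lambda>Y. real (snd Y e))"
    using iD unfolding eq[symmetric] by simp
  let ?c = "of_bool (0 < R e \<and> (\<forall>v\<in>e. 0 < L v)) :: real"
  have "measure_pmf.expectation (slot G arr p X) (\<lambda>Y. real (snd Y e)) = measure_pmf.expectation ?D real"
    unfolding eq[symmetric] by simp
  also have "\<dots> = measure_pmf.expectation p (\<lambda>M. real (R e) - real (service M L R e) + ?\<nu>)"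
    by (subst expectation_bind_pmf_nonneg) (use iD iK EK in auto)
  also have "\<dots> = measure_pmf.expectation p (\<lambda>M. real (R e) - indicator {M. e \<in> M} M * ?c + ?\<nu>)"
    by (rule Bochner_Integration.integral_cong) (auto simp: service_def)
  also have "\<dots> = real (R e) - measure_pmf.prob p {M. e \<in> M} * ?c + ?\<nu>"
    using fin by (simp add: integrable_measure_pmf_finite Bochner_Integration.integral_diff)
  finally show "measure_pmf.expectation (slot G arr p X) (\<lambda>Y. real (snd Y e)) =
      real (snd X e) - measure_pmf.prob p {M. e \<in> M} * of_bool (0 < snd X e \<and> (\<forall>v\<in>e. 0 < fst X v)) + ?\<nu>"
    by (simp add: X)
qed

lemma slot_request_square:
  fixes arr :: "('v set \<Rightarrow> nat) pmf"
  assumes fin: "finite (set_pmf p)"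
    and int: "integrable (measure_pmf arr) (\<lambda>a. (real (a e))\<^sup>2)"
  shows "integrable (measure_pmf (slot G arr p X)) (\<lambda>Y. (real (snd Y e) - c)\<^sup>2)" (is ?A)
    and "measure_pmf.expectation (slot G arr p X) (\<lambda>Y. (real (snd Y e) - c)\<^sup>2) \<le>
      2 * (real (snd X e) - c)\<^sup>2 + 2 * (1 + measure_pmf.expectation arr (\<lambda>a. (real (a e))\<^sup>2))" (is ?B)
proof -
  obtain L R where X: "X = (L, R)" by fastforce
  let ?D = "bind_pmf p (\<lambda>M. map_pmf (\<lambda>A. R e - service M L R e + A e) arr)"
  let ?h = "\<lambda>n. (real n - c)\<^sup>2"
  let ?b = "2 * (real (R e) - c)\<^sup>2 + 2 * (1 + measure_pmf.expectation arr (\<lambda>a. (real (a e))\<^sup>2))"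
  have eq: "map_pmf (\<lambda>Y. snd Y e) (slot G arr p X) = ?D"
    unfolding X by (rule slot_request_component)
  have pt: "?h (R e - s + a) \<le> 2 * (real (R e) - c)\<^sup>2 + 2 * (1 + (real a)\<^sup>2)"
    if "s \<le> R e" "s \<le> 1" for s a
  proof -
    have "?h (R e - s + a) = ((real (R e) - c) + (real a - real s))\<^sup>2"
      using that by (simp add: of_nat_diff algebra_simps)
    also have "\<dots> \<le> 2 * (real (R e) - c)\<^sup>2 + 2 * (real a - real s)\<^sup>2"
      using sum_squares_bound[of "real (R e) - c" "real a - real s"]
      by (simp add: power2_sum)
    also have "(real a - real s)\<^sup>2 \<le> 1 + (real a)\<^sup>2"
      using that(2) by (cases "s = 0") (auto simp: power2_diff le_Suc_eq)
    finally show ?thesis by simp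
  qed
  have ib: "integrable (measure_pmf arr) (\<lambda>A. 2 * (real (R e) - c)\<^sup>2 + 2 * (1 + (real (A e))\<^sup>2))"
    using int by simp
  have iK': "integrable (measure_pmf arr) (\<lambda>A. ?h (R e - service M L R e + A e))" for M
  proof (rule Bochner_Integration.integrable_bound[OF ib])
    have "norm (?h (R e - service M L R e + A e)) \<le> norm (2 * (real (R e) - c)\<^sup>2 + 2 * (1 + (real (A e))\<^sup>2))" for A
      unfolding real_norm_def abs_of_nonneg[OF zero_le_power2]
      by (rule order_trans[OF pt[OF service_le(1)[of M L R e] service_le(2)[of M L R e]] abs_ge_self])
    thus "AE A in measure_pmf arr. norm (?h (R e - service M L R e + A e))
        \<le> norm (2 * (real (R e) - c)\<^sup>2 + 2 * (1 + (real (A e))\<^sup>2))"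
      by (rule AE_I2)
  qed auto
  hence iK: "integrable (measure_pmf (map_pmf (\<lambda>A. R e - service M L R e + A e) arr)) ?h" for M
    by simp
  have EK: "measure_pmf.expectation (map_pmf (\<lambda>A. R e - service M L R e + A e) arr) ?h \<le> ?b" for M
  proof -
    have "measure_pmf.expectation (map_pmf (\<lambda>A. R e - service M L R e + A e) arr) ?h
        = measure_pmf.expectation arr (\<lambda>A. ?h (R e - service M L R e + A e))" by simp
    also have "\<dots> \<le> measure_pmf.expectation arr (\<lambda>A. 2 * (real (R e) - c)\<^sup>2 + 2 * (1 + (real (A e))\<^sup>2))"
      by (rule expectation_pmf_mono[OF iK' ib]) (rule pt[OF service_le(1)[of M L R e] service_le(2)[of M L R e]])
    also have "\<dots> = ?b" using int by simp
    finally show ?thesis .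
  qed
  have iD: "integrable (measure_pmf ?D) ?h"
    by (rule integrable_bind_pmf_nonneg[where g = "\<lambda>_. ?b"]) (use iK EK in auto)
  show ?A
    using iD unfolding eq[symmetric] by simp
  have "measure_pmf.expectation (slot G arr p X) (\<lambda>Y. ?h (snd Y e)) = measure_pmf.expectation ?D ?h"
    unfolding eq[symmetric] by simp
  also have "\<dots> = measure_pmf.expectation p
      (\<lambda>M. measure_pmf.expectation (map_pmf (\<lambda>A. R e - service M L R e + A e) arr) ?h)"
    by (rule expectation_bind_pmf_nonneg) (use iD iK in auto)
  also have "\<dots> \<le> measure_pmf.expectation p (\<lambda>_. ?b)"
    by (rule expectation_pmf_mono) (use fin EK in \<open>auto intro: integrable_measure_pmf_finite\<close>)
  finally show ?B by (simp add: X)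
qed

lemma frame_request_mean:
  fixes arr :: "('v set \<Rightarrow> nat) pmf"
  assumes fin: "finite (set_pmf p)"
    and int: "integrable (measure_pmf arr) (\<lambda>a. real (a e))"
  shows "integrable (measure_pmf (iter_pmf (slot G arr p) m X)) (\<lambda>Y. real (snd Y e))"
    and "measure_pmf.expectation (iter_pmf (slot G arr p) m X) (\<lambda>Y. real (snd Y e)) =
      real (snd X e) + real m * measure_pmf.expectation arr (\<lambda>a. real (a e)) -
      measure_pmf.prob p {M. e \<in> M} *
        (\<Sum>j<m. measure_pmf.prob (iter_pmf (slot G arr p) j X) {Y. 0 < snd Y e \<and> (\<forall>v\<in>e. 0 < fst Y v)})"
proof (induction m)
  case 0
  {
    case 1 show ?case by (simp add: integrable_measure_pmf_finite)
  next
    case 2 show ?case by simp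
  }
next
  case (Suc m)
  let ?D = "iter_pmf (slot G arr p) m X"
  let ?\<nu> = "measure_pmf.expectation arr (\<lambda>a. real (a e))"
  let ?q = "measure_pmf.prob p {M. e \<in> M}"
  let ?U = "{Y. 0 < snd Y e \<and> (\<forall>v\<in>e. 0 < fst Y v)}"
  let ?g = "\<lambda>Y. real (snd Y e) - ?q * indicator ?U Y + ?\<nu>"
  have iU: "integrable (measure_pmf ?D) (\<lambda>Y. ?q * indicator ?U Y)"
    by (intro integrable_mult_right integrable_pmf_bounded[where B = 1]) (auto simp: indicator_def)
  have ig: "integrable (measure_pmf ?D) ?g"
    using Suc(1) iU by (intro Bochner_Integration.integrable_add Bochner_Integration.integrable_diff) auto
  have slot: "integrable (measure_pmf (slot G arr p Y)) (\<lambda>Y. real (snd Y e))"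
    "measure_pmf.expectation (slot G arr p Y) (\<lambda>Y. real (snd Y e)) = ?g Y" for Y
    using slot_request_mean[where p = p and arr = arr and G = G and X = Y and e = e, OF fin int]
    by (simp_all add: indicator_def)
  have int_bind: "integrable (measure_pmf (bind_pmf ?D (slot G arr p))) (\<lambda>Y. real (snd Y e))"
    by (rule integrable_bind_pmf_nonneg[where g = ?g, OF _ slot(1) _ ig])
       (simp_all only: slot(2) of_nat_0_le_iff order.refl)
  {
    case 1
    show ?case unfolding iter_pmf.simps by (rule int_bind)
  next
    case 2
    have "measure_pmf.expectation (iter_pmf (slot G arr p) (Suc m) X) (\<lambda>Y. real (snd Y e))
        = measure_pmf.expectation ?D (\<lambda>Y. measure_pmf.expectation (slot G arr p Y) (\<lambda>Y. real (snd Y e)))"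
      unfolding iter_pmf.simps
      by (rule expectation_bind_pmf_nonneg[OF _ int_bind slot(1)]) simp
    also have "\<dots> = measure_pmf.expectation ?D ?g"
      by (simp only: slot(2))
    also have "\<dots> = measure_pmf.expectation ?D (\<lambda>Y. real (snd Y e)) - ?q * measure_pmf.prob ?D ?U + ?\<nu>"
      using Suc(1) iU by (simp add: Bochner_Integration.integral_diff)
    finally show ?case unfolding Suc(2) by (simp add: algebra_simps)
  }
qed

text \<open>
  The constant only has to be finite and independent of the state. With \<open>s\<close> the term in
  parentheses, a slot turns a bound \<open>b\<close> into \<open>2 b + 2 s\<close>, and \<open>4 ^ m * s\<close> absorbs this.
\<close>

lemma frame_request_square:
  fixes arr :: "('v set \<Rightarrow> nat) pmf"
  assumes fin: "finite (set_pmf p)"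
    and int: "integrable (measure_pmf arr) (\<lambda>a. (real (a e))\<^sup>2)"
  shows "integrable (measure_pmf (iter_pmf (slot G arr p) m X)) (\<lambda>Y. (real (snd Y e) - real (snd X e))\<^sup>2)"
    and "measure_pmf.expectation (iter_pmf (slot G arr p) m X) (\<lambda>Y. (real (snd Y e) - real (snd X e))\<^sup>2) \<le>
      4 ^ m * (1 + measure_pmf.expectation arr (\<lambda>a. (real (a e))\<^sup>2))"
proof (induction m)
  case 0
  {
    case 1 show ?case by (simp add: integrable_measure_pmf_finite)
  next
    case 2 show ?case by simp
  }
next
  case (Suc m)
  let ?D = "iter_pmf (slot G arr p) m X"
  let ?s = "1 + measure_pmf.expectation arr (\<lambda>a. (real (a e))\<^sup>2)"
  let ?f = "\<lambda>Y. (real (snd Y e) - real (snd X e))\<^sup>2"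
  let ?g = "\<lambda>Y. 2 * ?f Y + 2 * ?s"
  have ig: "integrable (measure_pmf ?D) ?g"
    using Suc(1) by auto
  have slot: "integrable (measure_pmf (slot G arr p Y)) ?f"
    "measure_pmf.expectation (slot G arr p Y) ?f \<le> ?g Y" for Y
    using slot_request_square[where p = p and arr = arr and G = G and X = Y and e = e, OF fin int]
    by simp_all
  have int_bind: "integrable (measure_pmf (bind_pmf ?D (slot G arr p))) ?f"
    by (rule integrable_bind_pmf_nonneg[where g = ?g, OF zero_le_power2 slot ig])
  {
    case 1
    show ?case unfolding iter_pmf.simps by (rule int_bind)
  next
    case 2
    have "measure_pmf.expectation (iter_pmf (slot G arr p) (Suc m) X) ?f
        = measure_pmf.expectation ?D (\<lambda>Y. measure_pmf.expectation (slot G arr p Y) ?f)"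
      unfolding iter_pmf.simps
      by (rule expectation_bind_pmf_nonneg[OF zero_le_power2 int_bind slot(1)])
    also have "\<dots> \<le> measure_pmf.expectation ?D ?g"
      by (rule integral_mono'[OF ig slot(2)]) (auto intro!: Bochner_Integration.integral_nonneg)
    also have "\<dots> = 2 * measure_pmf.expectation ?D ?f + 2 * ?s"
      using Suc(1) by simp
    also have "\<dots> \<le> 2 * (4 ^ m * ?s) + 2 * ?s"
      using Suc(2) by simp
    also have "\<dots> \<le> 4 ^ Suc m * ?s"
    proof -
      have "1 * ?s \<le> 4 ^ m * ?s"
        by (rule mult_right_mono) auto
      thus ?thesis by simp
    qed
    finally show ?case .
  }
qed

section \<open>Drift over a frame\<close>

lemma slot_support:
  assumes G: "valid_switch G" and arr: "set_pmf arr \<subseteq> request_states G"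
    and X: "X \<in> ent_states G \<times> request_states G" and Y: "Y \<in> set_pmf (slot G arr p X)"
  shows "Y \<in> ent_states G \<times> request_states G" and "snd X e \<le> snd Y e + 1"
proof -
  obtain L R where LR: "X = (L, R)" by fastforce
  from Y obtain M L' A where Y': "L' \<in> set_pmf (entanglement_step G (service M L R) L)"
    "A \<in> set_pmf arr" "Y = (L', \<lambda>e. R e - service M L R e + A e)"
    unfolding LR slot_def Let_def prod.case set_bind_pmf set_return_pmf by blast
  have "L' \<in> ent_states G"
    using Y'(1) set_entanglement_step[OF G] X by (auto simp: LR)
  moreover have "(\<lambda>e. R e - service M L R e + A e) \<in> request_states G"
  proof -
    have A: "A \<in> request_states G" using Y'(2) arr by blast
    have "A e = 0 \<and> R e = 0" if "e \<notin> edges G" for e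
      using that A X by (auto simp: LR request_states_def PiE_dflt_def)
    thus ?thesis by (auto simp: request_states_def PiE_dflt_def)
  qed
  ultimately show "Y \<in> ent_states G \<times> request_states G" by (simp add: Y'(3))
  show "snd X e \<le> snd Y e + 1"
    using service_le(2)[of M L R e] by (simp add: LR Y'(3))
qed

lemma frame_support:
  assumes G: "valid_switch G" and arr: "set_pmf arr \<subseteq> request_states G"
    and X: "X \<in> ent_states G \<times> request_states G"
    and Y: "Y \<in> set_pmf (iter_pmf (slot G arr p) m X)"
  shows "Y \<in> ent_states G \<times> request_states G \<and> snd X e \<le> snd Y e + m"
  using Y
proof (induction m arbitrary: Y)
  case 0
  thus ?case using X by simp
next
  case (Suc m)
  then obtain Z where Z: "Z \<in> set_pmf (iter_pmf (slot G arr p) m X)" "Y \<in> set_pmf (slot G arr p Z)"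
    by auto
  have "Z \<in> ent_states G \<times> request_states G" "snd X e \<le> snd Z e + m"
    using Suc.IH[OF Z(1)] by blast+
  hence "Y \<in> ent_states G \<times> request_states G" "snd Z e \<le> snd Y e + 1"
    using slot_support[OF G arr _ Z(2)] by blast+
  with \<open>snd X e \<le> snd Z e + m\<close> show ?case by simp
qed

text \<open>
  A queue that starts above \<open>m\<close> is still nonempty after \<open>m\<close> slots. The edge can then be served
  unless one of its two buffers is empty, and a union bound suffices.
\<close>

lemma edge_availability:
  assumes G: "valid_switch G" and arr: "set_pmf arr \<subseteq> request_states G"
    and X: "X \<in> ent_states G \<times> request_states G"
    and p: "set_pmf p \<subseteq> matchings G"
    and cover: "\<And>u. u \<in> nodes G \<Longrightarrow>
      (\<Sum>e\<in>incident G u. measure_pmf.prob p {M. e \<in> M}) \<le> 2/3 * gen_prob G u"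
    and uv: "{u, v} \<in> edges G" and big: "m < snd X {u, v}"
  defines "W \<equiv> \<lambda>u. measure_pmf.expectation (iter_pmf (reference_step G u) m (fst X u)) (\<lambda>n. of_bool (0 < n))"
  shows "W u + W v - 1
    \<le> measure_pmf.prob (iter_pmf (slot G arr p) m X) {Y. 0 < snd Y {u, v} \<and> (\<forall>w\<in>{u, v}. 0 < fst Y w)}"
proof -
  let ?D = "iter_pmf (slot G arr p) m X"
  have occ: "W w \<le> measure_pmf.prob ?D {Y. 0 < fst Y w}" if w: "w \<in> nodes G" for w
  proof -
    have "W w \<le> measure_pmf.expectation ?D (\<lambda>Y. of_bool (0 < fst Y w))"
      unfolding W_def
      by (rule frame_dominates_reference[OF G w p cover[OF w], where B = 1]) (auto intro!: monoI)
    also have "(\<lambda>Y. of_bool (0 < fst Y w) :: real) = indicator {Y :: 'a state. 0 < fst Y w}"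
      by (auto simp: indicator_def fun_eq_iff)
    finally show ?thesis by simp
  qed
  have nodes: "u \<in> nodes G" "v \<in> nodes G" using edge_subset[OF G uv] by auto
  let ?A = "{Y :: 'a state. 0 < fst Y u}" and ?B = "{Y :: 'a state. 0 < fst Y v}"
  have "measure_pmf.prob ?D ?A + measure_pmf.prob ?D ?B
      = measure_pmf.prob ?D (?A \<union> ?B) + measure_pmf.prob ?D (?A \<inter> ?B)"
  proof -
    have "measure_pmf.prob ?D (?A \<union> ?B) = measure_pmf.prob ?D ?A + measure_pmf.prob ?D (?B - ?A)"
      by (rule measure_pmf.finite_measure_Union') auto
    moreover have "measure_pmf.prob ?D (?B - ?A) = measure_pmf.prob ?D ?B - measure_pmf.prob ?D (?B \<inter> ?A)"
      by (rule measure_pmf.finite_measure_Diff') auto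
    ultimately show ?thesis by (simp only: Int_commute)
  qed
  also have "\<dots> \<le> 1 + measure_pmf.prob ?D (?A \<inter> ?B)" by simp
  also have "measure_pmf.prob ?D (?A \<inter> ?B) =
      measure_pmf.prob ?D {Y. 0 < snd Y {u, v} \<and> (\<forall>w\<in>{u, v}. 0 < fst Y w)}"
  proof (rule measure_pmf.finite_measure_eq_AE)
    have "0 < snd Y {u, v}" if "Y \<in> set_pmf ?D" for Y
      using frame_support[OF G arr X that, of "{u, v}"] big by simp
    thus "AE Y in measure_pmf ?D. (Y \<in> ?A \<inter> ?B) =
        (Y \<in> {Y. 0 < snd Y {u, v} \<and> (\<forall>w\<in>{u, v}. 0 < fst Y w)})"
      by (auto intro!: AE_pmfI)
  qed auto
  finally show ?thesis using occ[OF nodes(1)] occ[OF nodes(2)] by linarith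
qed

lemma node_coherence_le_1: "node_coherence G u \<le> 1"
  by (simp add: node_coherence_def)

text \<open>
  A queue shorter than \<open>T\<close> may run empty within the frame, but then its weight is less than
  \<open>T\<close>, and the services that are lost cost at most \<open>T\<^sup>2\<close>.
\<close>

lemma frame_edge_drift:
  assumes G: "valid_switch G" and arr: "request_arrivals G \<nu> arr"
    and X: "X \<in> ent_states G \<times> request_states G"
    and p: "set_pmf p \<subseteq> matchings G"
    and cover: "\<And>u. u \<in> nodes G \<Longrightarrow>
      (\<Sum>e\<in>incident G u. measure_pmf.prob p {M. e \<in> M}) \<le> 2/3 * gen_prob G u"
    and H: "0 \<le> H" "\<And>u T l. u \<in> nodes G \<Longrightarrow> l \<le> buf G u \<Longrightarrow> real T * node_coherence G u - H
      \<le> (\<Sum>m<T. measure_pmf.expectation (iter_pmf (reference_step G u) m l) (\<lambda>n. of_bool (0 < n)))"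
    and \<Gamma>: "\<And>u v. {u, v} \<in> edges G \<Longrightarrow> \<Gamma> \<le> node_coherence G u + node_coherence G v - 1"
    and e: "e \<in> edges G"
  shows "real (snd X e) *
      (measure_pmf.expectation (iter_pmf (slot G arr p) T X) (\<lambda>Y. real (snd Y e)) - real (snd X e))
    \<le> real (snd X e) * (real T * \<nu> e - measure_pmf.prob p {M. e \<in> M} * (real T * \<Gamma> - 2 * H)) + (real T)\<^sup>2"
proof -
  let ?q = "measure_pmf.prob p {M. e \<in> M}"
  let ?U = "{Y. 0 < snd Y e \<and> (\<forall>v\<in>e. 0 < fst Y v)}"
  let ?S = "\<Sum>j<T. measure_pmf.prob (iter_pmf (slot G arr p) j X) ?U"
  let ?r = "real (snd X e)"
  have arr': "set_pmf arr \<subseteq> request_states G" "integrable (measure_pmf arr) (\<lambda>a. real (a e))"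
    "measure_pmf.expectation arr (\<lambda>a. real (a e)) = \<nu> e"
    using arr e by (auto simp: request_arrivals_def)
  obtain u v where uv: "e = {u, v}" using card_edge[OF G e] by (auto simp: card_2_iff)
  have nodes: "u \<in> nodes G" "v \<in> nodes G" using edge_subset[OF G e] uv by auto
  have mean: "measure_pmf.expectation (iter_pmf (slot G arr p) T X) (\<lambda>Y. real (snd Y e)) - ?r
      = real T * \<nu> e - ?q * ?S"
    using frame_request_mean(2)[OF finite_scheduler[OF G p] arr'(2), of G T X] arr'(3) by simp
  have "?r * (?q * (real T * \<Gamma> - 2 * H)) \<le> ?r * (?q * ?S) + (real T)\<^sup>2"
  proof (cases "T \<le> snd X e")
    case True
    define W where "W = (\<lambda>u m. measure_pmf.expectation
      (iter_pmf (reference_step G u) m (fst X u)) (\<lambda>n. of_bool (0 < n) :: real))"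
    have W: "real T * node_coherence G w - H \<le> (\<Sum>m<T. W w m)" if "w \<in> nodes G" for w
      unfolding W_def using that X by (intro H(2)) (auto simp: ent_states_def PiE_dflt_def)
    have "real T * \<Gamma> - 2 * H \<le> real T * (node_coherence G u + node_coherence G v - 1) - 2 * H"
      using \<Gamma>[of u v] e uv by (intro diff_right_mono mult_left_mono) auto
    also have "\<dots> \<le> (\<Sum>m<T. W u m) + (\<Sum>m<T. W v m) - real T"
      using W[OF nodes(1)] W[OF nodes(2)] by (simp add: algebra_simps)
    also have "\<dots> = (\<Sum>m<T. W u m + W v m - 1)"
      by (simp add: sum.distrib sum_subtractf)
    also have "\<dots> \<le> ?S"
    proof (rule sum_mono)
      fix m assume "m \<in> {..<T}"
      hence "m < snd X {u, v}" using True uv by simp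
      thus "W u m + W v m - 1 \<le> measure_pmf.prob (iter_pmf (slot G arr p) m X) ?U"
        unfolding W_def uv using e uv
        by (intro edge_availability[OF G arr'(1) X p cover]) auto
    qed
    finally have "?r * (?q * (real T * \<Gamma> - 2 * H)) \<le> ?r * (?q * ?S)"
      by (intro mult_left_mono) auto
    thus ?thesis using zero_le_power2[of "real T"] by linarith
  next
    case False
    have "\<Gamma> \<le> 1"
      using \<Gamma>[of u v] e uv node_coherence_le_1[of G u] node_coherence_le_1[of G v] by simp
    hence "real T * \<Gamma> - 2 * H \<le> real T * 1"
      using H(1) mult_left_mono[of \<Gamma> 1 "real T"] by linarith
    hence "?q * (real T * \<Gamma> - 2 * H) \<le> ?q * real T"
      by (intro mult_left_mono) auto
    also have "\<dots> \<le> 1 * real T" by (intro mult_right_mono) auto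
    finally have "?r * (?q * (real T * \<Gamma> - 2 * H)) \<le> ?r * real T"
      by (intro mult_left_mono) auto
    also have "\<dots> \<le> real T * real T" using False by (intro mult_right_mono) auto
    also have "\<dots> = (real T)\<^sup>2" by (simp add: power2_eq_square)
    moreover have "0 \<le> ?r * (?q * ?S)"
      by (intro mult_nonneg_nonneg sum_nonneg) auto
    ultimately show ?thesis by linarith
  qed
  thus ?thesis unfolding mean by (simp add: algebra_simps)
qed

lemma frame_lyapunov_drift:
  assumes G: "valid_switch G" and arr: "request_arrivals G \<nu> arr"
    and X: "X \<in> ent_states G \<times> request_states G"
    and p: "set_pmf p \<subseteq> matchings G"
    and cover: "\<And>u. u \<in> nodes G \<Longrightarrow>
      (\<Sum>e\<in>incident G u. measure_pmf.prob p {M. e \<in> M}) \<le> 2/3 * gen_prob G u"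
    and H: "0 \<le> H" "\<And>u T l. u \<in> nodes G \<Longrightarrow> l \<le> buf G u \<Longrightarrow> real T * node_coherence G u - H
      \<le> (\<Sum>m<T. measure_pmf.expectation (iter_pmf (reference_step G u) m l) (\<lambda>n. of_bool (0 < n)))"
    and \<Gamma>: "\<And>u v. {u, v} \<in> edges G \<Longrightarrow> \<Gamma> \<le> node_coherence G u + node_coherence G v - 1"
  shows "measure_pmf.expectation (iter_pmf (slot G arr p) T X)
      (\<lambda>Y. lyapunov G (snd Y) - lyapunov G (snd X))
    \<le> (\<Sum>e\<in>edges G. real (snd X e) * (real T * \<nu> e - measure_pmf.prob p {M. e \<in> M} * (real T * \<Gamma> - 2 * H)))
      + (\<Sum>e\<in>edges G. (real T)\<^sup>2 + 1/2 * (4 ^ T * (1 + measure_pmf.expectation arr (\<lambda>a. (real (a e))\<^sup>2))))"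
proof -
  let ?D = "iter_pmf (slot G arr p) T X"
  let ?r = "\<lambda>e. real (snd X e)"
  have int: "integrable (measure_pmf arr) (\<lambda>a. real (a e))"
    "integrable (measure_pmf arr) (\<lambda>a. (real (a e))\<^sup>2)" if "e \<in> edges G" for e
    using arr that by (auto simp: request_arrivals_def)
  note fin = finite_scheduler[OF G p]
  have i1: "integrable (measure_pmf ?D) (\<lambda>Y. ?r e * (real (snd Y e) - ?r e))" if "e \<in> edges G" for e
    using frame_request_mean(1)[OF fin int(1)[OF that]] by auto
  have i2: "integrable (measure_pmf ?D) (\<lambda>Y. 1/2 * (real (snd Y e) - ?r e)\<^sup>2)" if "e \<in> edges G" for e
    using frame_request_square(1)[OF fin int(2)[OF that], of G T X] by (intro integrable_mult_right)
  \<comment> \<open>\<open>(r + d)\<^sup>2 / 2 - r\<^sup>2 / 2 = r * d + d\<^sup>2 / 2\<close> on every edge\<close>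
  have "lyapunov G (snd Y) - lyapunov G (snd X) =
      (\<Sum>e\<in>edges G. ?r e * (real (snd Y e) - ?r e) + 1/2 * (real (snd Y e) - ?r e)\<^sup>2)" for Y
    unfolding lyapunov_def right_diff_distrib[symmetric] sum_subtractf[symmetric]
    unfolding sum_distrib_left
    by (rule sum.cong) (auto simp: power2_diff field_simps power2_eq_square)
  hence "measure_pmf.expectation ?D (\<lambda>Y. lyapunov G (snd Y) - lyapunov G (snd X)) =
      measure_pmf.expectation ?D
        (\<lambda>Y. \<Sum>e\<in>edges G. ?r e * (real (snd Y e) - ?r e) + 1/2 * (real (snd Y e) - ?r e)\<^sup>2)"
    by (intro Bochner_Integration.integral_cong refl)
  also have "\<dots> = (\<Sum>e\<in>edges G. measure_pmf.expectation ?D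
        (\<lambda>Y. ?r e * (real (snd Y e) - ?r e) + 1/2 * (real (snd Y e) - ?r e)\<^sup>2))"
    by (rule Bochner_Integration.integral_sum) (intro Bochner_Integration.integrable_add i1 i2)
  also have "\<dots> \<le> (\<Sum>e\<in>edges G.
      (?r e * (real T * \<nu> e - measure_pmf.prob p {M. e \<in> M} * (real T * \<Gamma> - 2 * H)) + (real T)\<^sup>2)
      + 1/2 * (4 ^ T * (1 + measure_pmf.expectation arr (\<lambda>a. (real (a e))\<^sup>2))))"
  proof (rule sum_mono)
    fix e assume e: "e \<in> edges G"
    have "measure_pmf.expectation ?D (\<lambda>Y. ?r e * (real (snd Y e) - ?r e) + 1/2 * (real (snd Y e) - ?r e)\<^sup>2)
        = measure_pmf.expectation ?D (\<lambda>Y. ?r e * (real (snd Y e) - ?r e))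
          + measure_pmf.expectation ?D (\<lambda>Y. 1/2 * (real (snd Y e) - ?r e)\<^sup>2)"
      by (rule Bochner_Integration.integral_add[OF i1[OF e] i2[OF e]])
    also have "measure_pmf.expectation ?D (\<lambda>Y. ?r e * (real (snd Y e) - ?r e))
        = ?r e * (measure_pmf.expectation ?D (\<lambda>Y. real (snd Y e)) - ?r e)"
      using frame_request_mean(1)[OF fin int(1)[OF e], of G T X]
      by (simp add: Bochner_Integration.integral_diff)
    also have "\<dots> \<le> ?r e * (real T * \<nu> e - measure_pmf.prob p {M. e \<in> M} * (real T * \<Gamma> - 2 * H)) + (real T)\<^sup>2"
      by (rule frame_edge_drift[OF G arr X p cover H \<Gamma> e])
    also have "measure_pmf.expectation ?D (\<lambda>Y. 1/2 * (real (snd Y e) - ?r e)\<^sup>2)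
        \<le> 1/2 * (4 ^ T * (1 + measure_pmf.expectation arr (\<lambda>a. (real (a e))\<^sup>2)))"
      using frame_request_square(2)[OF fin int(2)[OF e], of G T X] by simp
    finally show "measure_pmf.expectation ?D (\<lambda>Y. ?r e * (real (snd Y e) - ?r e) + 1/2 * (real (snd Y e) - ?r e)\<^sup>2)
        \<le> (?r e * (real T * \<nu> e - measure_pmf.prob p {M. e \<in> M} * (real T * \<Gamma> - 2 * H)) + (real T)\<^sup>2)
      + 1/2 * (4 ^ T * (1 + measure_pmf.expectation arr (\<lambda>a. (real (a e))\<^sup>2)))"
      by simp
  qed
  finally show ?thesis by (simp add: sum.distrib add.assoc)
qed

section \<open>Conditioning the trajectory on the beginning of a frame\<close>

lemma trajectory_support:
  assumes G: "valid_switch G" and arr: "set_pmf arr \<subseteq> request_states G"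
    and init: "set_pmf init \<subseteq> ent_states G \<times> request_states G"
    and h: "h \<in> set_pmf (trajectory G arr sched T init t)"
  shows "length h = Suc t \<and> set h \<subseteq> ent_states G \<times> request_states G"
  using h
proof (induction t arbitrary: h)
  case 0
  thus ?case using init by auto
next
  case (Suc t)
  then obtain h' Y where h': "h' \<in> set_pmf (trajectory G arr sched T init t)"
    "Y \<in> set_pmf (slot G arr (sched (snd (h' ! (t div T * T)))) (h' ! t))" "h = h' @ [Y]"
    by auto
  note IH = Suc.IH[OF h'(1)]
  hence "h' ! t \<in> ent_states G \<times> request_states G"
    using nth_mem[of t h'] by auto
  from slot_support(1)[OF G arr this h'(2)] IH h'(3) show ?case by auto
qed

lemma length_trajectory: "h \<in> set_pmf (trajectory G arr sched T init t) \<Longrightarrow> length h = Suc t"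
  by (induction t arbitrary: h) auto

text \<open>
  Within a frame the scheduler sees only the state at the beginning of the frame, so given that
  state the switch is a time-homogeneous Markov chain.
\<close>

lemma trajectory_frame:
  assumes "m \<le> T"
  shows "map_pmf (\<lambda>h. (h ! (k * T), h ! (k * T + m))) (trajectory G arr sched T init (k * T + m)) =
    bind_pmf (map_pmf (\<lambda>h. h ! (k * T)) (trajectory G arr sched T init (k * T)))
      (\<lambda>X. map_pmf (Pair X) (iter_pmf (slot G arr (sched (snd X))) m X))"
  using assms
proof (induction m)
  case 0
  show ?case by (simp add: bind_map_pmf map_pmf_def bind_assoc_pmf bind_return_pmf)
next
  case (Suc m)
  let ?P = "trajectory G arr sched T init"
  have div: "(k * T + m) div T * T = k * T" using Suc.prems by simp
  have "map_pmf (\<lambda>h. (h ! (k * T), h ! (k * T + Suc m))) (?P (k * T + Suc m)) =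
      bind_pmf (?P (k * T + m)) (\<lambda>h. map_pmf (Pair (h ! (k * T)))
        (slot G arr (sched (snd (h ! (k * T)))) (h ! (k * T + m))))"
    unfolding add_Suc_right trajectory.simps div map_bind_pmf
  proof (rule bind_pmf_cong[OF refl])
    fix h assume "h \<in> set_pmf (?P (k * T + m))"
    hence "length h = Suc (k * T + m)" by (rule length_trajectory)
    thus "bind_pmf (slot G arr (sched (snd (h ! (k * T)))) (h ! (k * T + m)))
        (\<lambda>X. map_pmf (\<lambda>h. (h ! (k * T), h ! Suc (k * T + m))) (return_pmf (h @ [X])))
      = map_pmf (Pair (h ! (k * T))) (slot G arr (sched (snd (h ! (k * T)))) (h ! (k * T + m)))"
      by (simp add: nth_append map_pmf_def bind_return_pmf)
  qed
  also have "\<dots> = bind_pmf (map_pmf (\<lambda>h. (h ! (k * T), h ! (k * T + m))) (?P (k * T + m)))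
      (\<lambda>(X, Y). map_pmf (Pair X) (slot G arr (sched (snd X)) Y))"
    by (simp add: bind_map_pmf)
  also have "\<dots> = bind_pmf (map_pmf (\<lambda>h. h ! (k * T)) (?P (k * T)))
      (\<lambda>X. map_pmf (Pair X) (iter_pmf (slot G arr (sched (snd X))) (Suc m) X))"
    using Suc by (simp add: bind_assoc_pmf bind_map_pmf map_bind_pmf)
  finally show ?case .
qed

lemma cond_pmf_bind_Pair:
  assumes x: "x \<in> set_pmf D"
  shows "cond_pmf (bind_pmf D (\<lambda>x. map_pmf (Pair x) (F x))) {z. fst z = x} = map_pmf (Pair x) (F x)"
proof (rule pmf_eqI)
  fix z :: "'a \<times> 'b"
  obtain a b where z: "z = (a, b)" by fastforce
  let ?J = "bind_pmf D (\<lambda>x. map_pmf (Pair x) (F x))"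
  have mapP: "pmf (map_pmf (Pair c) (F c)) (a, b) = indicator {a} c * pmf (F a) b" for c
  proof (cases "c = a")
    case True
    thus ?thesis using pmf_map_inj'[of "Pair a" "F a" b] by (simp add: inj_on_def)
  next
    case False
    thus ?thesis by (subst pmf_map_outside) auto
  qed
  have J: "pmf ?J (a, b) = pmf D a * pmf (F a) b"
    unfolding pmf_bind mapP by (simp add: measure_pmf_single)
  have "map_pmf fst ?J = D"
    by (simp add: map_bind_pmf pmf.map_comp o_def bind_return_pmf')
  hence "measure_pmf.prob (map_pmf fst ?J) {x} = pmf D x"
    by (simp only: measure_pmf_single)
  moreover have "fst -` {x} = {z :: 'a \<times> 'b. fst z = x}" by auto
  ultimately have m: "measure_pmf.prob ?J {z. fst z = x} = pmf D x"
    by (simp only: measure_map_pmf)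
  have "pmf D x \<noteq> 0"
    using x by (simp add: set_pmf_iff)
  hence "set_pmf ?J \<inter> {z. fst z = x} \<noteq> {}"
    unfolding measure_pmf_zero_iff[symmetric] m .
  from pmf_cond[OF this, of z] show "pmf (cond_pmf ?J {z. fst z = x}) z = pmf (map_pmf (Pair x) (F x)) z"
    using x unfolding z mem_Collect_eq fst_conv m J mapP[of x]
    by (cases "a = x") (auto simp: pmf_eq_0_set_pmf)
qed

lemma cond_trajectory_expectation:
  fixes f :: "'v state \<Rightarrow> 'v state \<Rightarrow> real"
  assumes pos: "0 < measure_pmf.prob (trajectory G arr sched T init ((k + 1) * T)) {h. h ! (k * T) = X}"
  shows "measure_pmf.expectation
      (cond_pmf (trajectory G arr sched T init ((k + 1) * T)) {h. h ! (k * T) = X})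
      (\<lambda>h. f (h ! (k * T)) (h ! ((k + 1) * T)))
    = measure_pmf.expectation (iter_pmf (slot G arr (sched (snd X))) T X) (f X)"
proof -
  let ?P = "trajectory G arr sched T init ((k + 1) * T)"
  let ?\<phi> = "\<lambda>h :: 'v state list. (h ! (k * T), h ! ((k + 1) * T))"
  let ?D = "map_pmf (\<lambda>h. h ! (k * T)) (trajectory G arr sched T init (k * T))"
  let ?F = "\<lambda>X. iter_pmf (slot G arr (sched (snd X))) T X"
  have E: "?\<phi> -` {z. fst z = X} = {h. h ! (k * T) = X}" by auto
  have ne: "set_pmf ?P \<inter> ?\<phi> -` {z. fst z = X} \<noteq> {}"
    unfolding E measure_pmf_zero_iff[symmetric] using pos by (simp only: less_irrefl not_False_eq_True order_less_imp_not_eq2)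
  have law: "map_pmf ?\<phi> ?P = bind_pmf ?D (\<lambda>X. map_pmf (Pair X) (?F X))"
    using trajectory_frame[of T T k G arr sched init] by (simp add: add.commute)
  have "X \<in> set_pmf ?D"
  proof -
    from ne obtain h where h: "h \<in> set_pmf ?P" "h ! (k * T) = X" by auto
    have "?\<phi> h \<in> set_pmf (map_pmf ?\<phi> ?P)"
      unfolding set_map_pmf using h(1) by (rule imageI)
    thus ?thesis unfolding law using h(2) by auto
  qed
  from cond_pmf_bind_Pair[OF this, of ?F]
  have "map_pmf ?\<phi> (cond_pmf ?P {h. h ! (k * T) = X}) = map_pmf (Pair X) (?F X)"
    using cond_map_pmf[OF ne] unfolding law E by (simp only:)
  hence "measure_pmf.expectation (map_pmf ?\<phi> (cond_pmf ?P {h. h ! (k * T) = X})) (\<lambda>z. f (fst z) (snd z))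
      = measure_pmf.expectation (map_pmf (Pair X) (?F X)) (\<lambda>z. f (fst z) (snd z))"
    by simp
  thus ?thesis by simp
qed

section \<open>Stability\<close>

text \<open>
  As the coherence factor is positive, the positive part in its definition is inactive on every
  edge.
\<close>

lemma coherence_factor_le:
  assumes G: "valid_switch G" and pos: "0 < coherence_factor G" and uv: "{u, v} \<in> edges G"
  shows "coherence_factor G \<le> node_coherence G u + node_coherence G v - 1"
proof -
  let ?c = "\<lambda>u v. max (node_coherence G u + node_coherence G v - 1) 0"
  let ?A = "{?c u v | u v. {u, v} \<in> edges G}"
  have "?A \<subseteq> (\<lambda>(u, v). ?c u v) ` (nodes G \<times> nodes G)"
    using edge_subset[OF G] by fastforce
  hence "finite ?A"
    by (rule finite_subset) (simp add: finite_nodes[OF G])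
  hence "coherence_factor G \<le> ?c u v"
    unfolding coherence_factor_def by (rule Min_le) (use uv in blast)
  thus ?thesis using pos by linarith
qed

lemma scheduler_marginal:
  assumes G: "valid_switch G" and p: "set_pmf p \<subseteq> matchings G"
  shows "(\<Sum>M\<in>matchings G. pmf p M * indicator M e) = measure_pmf.prob p {M. e \<in> M}"
proof -
  have "measure_pmf.prob p {M. e \<in> M} = measure_pmf.expectation p (indicator {M. e \<in> M})"
    by simp
  also have "\<dots> = (\<Sum>M\<in>matchings G. pmf p M * indicator M e)"
    by (subst integral_measure_pmf[of "matchings G"])
       (use finite_matchings[OF G] p in \<open>auto simp: indicator_def\<close>)
  finally show ?thesis ..
qed

text \<open>
  Membership in the capacity region is strict on each of finitely many edges, which leaves a
  uniform gap \<open>\<eta>\<close> below a feasible point of the LP. The extra element \<open>1\<close> in the minimum serves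
  the graph without edges.
\<close>

lemma capacity_region_slack:
  assumes G: "valid_switch G" and \<nu>: "\<nu>' \<in> capacity_region G"
  shows "\<exists>\<eta>>0. \<exists>y. lp_feasible G y \<and> (\<forall>e\<in>edges G. \<nu>' e + \<eta> \<le> y e)"
proof -
  obtain \<pi> where \<pi>: "agnostic_policy G \<pi>" and
    lt: "\<forall>e\<in>edges G. \<nu>' e < (\<Sum>L\<in>{L \<in> ent_states G. \<forall>v\<in>e. 0 < L v}.
                   \<Sum>M\<in>{M \<in> matchings G. e \<in> M}.
                     pmf (\<pi> L) M *
                     pmf (stationary_distribution (ent_states G) (agnostic_step G \<pi>)) L)"
    using \<nu> by (auto simp: capacity_region_def)
  define y where "y = (\<lambda>e. \<Sum>L\<in>{L \<in> ent_states G. \<forall>v\<in>e. 0 < L v}.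
                   \<Sum>M\<in>{M \<in> matchings G. e \<in> M}.
                     pmf (\<pi> L) M *
                     pmf (stationary_distribution (ent_states G) (agnostic_step G \<pi>)) L)"
  have y: "lp_feasible G y"
    unfolding y_def by (rule agnostic_rates_lp_feasible[OF G \<pi>])
  let ?S = "insert 1 ((\<lambda>e. y e - \<nu>' e) ` edges G)"
  have fin: "finite ?S" using finite_edges[OF G] by simp
  have pos: "\<forall>s\<in>?S. 0 < s" using lt by (simp add: y_def)
  have "0 < Min ?S" using fin pos by (subst Min_gr_iff) auto
  moreover have "\<nu>' e + Min ?S \<le> y e" if "e \<in> edges G" for e
  proof -
    have "Min ?S \<le> y e - \<nu>' e" using fin that by (intro Min_le) auto
    thus ?thesis by linarith
  qed
  ultimately show ?thesis using y by blast
qed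

lemma finite_request_sublevel:
  assumes G: "valid_switch G"
  shows "finite {r \<in> request_states G. (\<Sum>e\<in>edges G. real (r e)) \<le> N}"
proof (rule finite_subset)
  show "{r \<in> request_states G. (\<Sum>e\<in>edges G. real (r e)) \<le> N}
      \<subseteq> PiE_dflt (edges G) 0 (\<lambda>_. {.. nat \<lceil>N\<rceil>})"
  proof
    fix r assume r: "r \<in> {r \<in> request_states G. (\<Sum>e\<in>edges G. real (r e)) \<le> N}"
    have "r e \<le> nat \<lceil>N\<rceil>" if "e \<in> edges G" for e
    proof -
      have "real (r e) \<le> (\<Sum>e\<in>edges G. real (r e))"
        by (rule member_le_sum) (use that finite_edges[OF G] in auto)
      hence "real (r e) \<le> N" using r by simp
      thus ?thesis by linarith
    qed
    thus "r \<in> PiE_dflt (edges G) 0 (\<lambda>_. {.. nat \<lceil>N\<rceil>})"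
      using r by (auto simp: request_states_def PiE_dflt_def)
  qed
  show "finite (PiE_dflt (edges G) (0::nat) (\<lambda>_. {.. nat \<lceil>N\<rceil>}))"
    by (intro finite_PiE_dflt finite_edges[OF G]) auto
qed

text \<open>
  The drift over a frame is negative outside a bounded set of request vectors, uniformly in the
  entanglement levels and in the choices of the scheduler.
\<close>

lemma frame_drift_bound:
  fixes G :: "'v switch"
  assumes G: "valid_switch G" and arr: "request_arrivals G \<nu> arr"
    and \<Gamma>: "0 < coherence_factor G" and \<epsilon>: "0 < \<epsilon>"
    and \<nu>: "(\<lambda>e. (1 + \<epsilon>) / (2/3 * coherence_factor G) * \<nu> e) \<in> capacity_region G"
  shows "\<exists>T\<ge>1. \<exists>c>0. \<exists>K. \<forall>sched. simplified_scheduler G sched \<longrightarrow>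
    (\<forall>X\<in>ent_states G \<times> request_states G.
      measure_pmf.expectation (iter_pmf (slot G arr (sched (snd X))) T X)
        (\<lambda>Y. lyapunov G (snd Y) - lyapunov G (snd X)) \<le> K - c * (\<Sum>e\<in>edges G. real (snd X e)))"
proof -
  let ?\<Gamma> = "coherence_factor G"
  define \<kappa> where "\<kappa> = 2/3 * ?\<Gamma> / (1 + \<epsilon>)"
  have \<kappa>: "0 < \<kappa>" using \<Gamma> \<epsilon> by (simp add: \<kappa>_def)
  define \<nu>' where "\<nu>' = (\<lambda>e. (1 + \<epsilon>) / (2/3 * ?\<Gamma>) * \<nu> e)"
  have \<nu>': "\<nu> e = \<kappa> * \<nu>' e" for e
  proof -
    have "\<kappa> * ((1 + \<epsilon>) / (2/3 * ?\<Gamma>)) = 1"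
      using \<Gamma> \<epsilon> unfolding \<kappa>_def by (simp add: add_pos_pos less_imp_neq[symmetric])
    thus ?thesis unfolding \<nu>'_def mult.assoc[symmetric] by (simp only: mult_1_left)
  qed
  obtain \<eta> y where \<eta>: "0 < \<eta>" and y: "lp_feasible G y" "\<And>e. e \<in> edges G \<Longrightarrow> \<nu>' e + \<eta> \<le> y e"
    using capacity_region_slack[OF G \<nu>] unfolding \<nu>'_def by blast
  obtain H where H: "0 \<le> H" "\<And>u T l. u \<in> nodes G \<Longrightarrow> l \<le> buf G u \<Longrightarrow> real T * node_coherence G u - H
      \<le> (\<Sum>m<T. measure_pmf.expectation (iter_pmf (reference_step G u) m l) (\<lambda>n. of_bool (0 < n)))"
    using reference_occupation[OF G] by blast
  \<comment> \<open>so long a frame that the boundary term \<open>2 H\<close> uses up at most the share of the service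
    rate that the factor \<open>1 + \<epsilon>\<close> sets aside, see \<open>rate\<close> below\<close>
  obtain T :: nat where T: "2 * H * (1 + \<epsilon>) / (?\<Gamma> * \<epsilon>) < real T"
    using reals_Archimedean2 by blast
  have "0 \<le> 2 * H * (1 + \<epsilon>) / (?\<Gamma> * \<epsilon>)" using H(1) \<Gamma> \<epsilon> by simp
  hence T1: "1 \<le> T" using T by linarith
  have rate: "2/3 * (real T * ?\<Gamma> - 2 * H) \<ge> real T * \<kappa>"
  proof -
    have "2 * H * (1 + \<epsilon>) \<le> real T * (?\<Gamma> * \<epsilon>)"
      using T \<Gamma> \<epsilon> by (simp add: pos_divide_less_eq)
    hence "real T * ?\<Gamma> \<le> (real T * ?\<Gamma> - 2 * H) * (1 + \<epsilon>)"
      by (simp add: algebra_simps)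
    hence "real T * ?\<Gamma> / (1 + \<epsilon>) \<le> real T * ?\<Gamma> - 2 * H"
      using \<epsilon> by (simp add: pos_divide_le_eq)
    hence "2/3 * (real T * ?\<Gamma> / (1 + \<epsilon>)) \<le> 2/3 * (real T * ?\<Gamma> - 2 * H)"
      by (rule mult_left_mono) simp
    moreover have "real T * \<kappa> = 2/3 * (real T * ?\<Gamma> / (1 + \<epsilon>))"
      unfolding \<kappa>_def by (simp only: times_divide_eq_right mult.left_commute)
    ultimately show ?thesis by (simp only:)
  qed
  define K where "K = (\<Sum>e\<in>edges G. (real T)\<^sup>2 +
    1/2 * (4 ^ T * (1 + measure_pmf.expectation arr (\<lambda>a. (real (a e))\<^sup>2))))"
  have "measure_pmf.expectation (iter_pmf (slot G arr (sched (snd X))) T X)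
        (\<lambda>Y. lyapunov G (snd Y) - lyapunov G (snd X))
      \<le> K - (real T * \<kappa> * \<eta>) * (\<Sum>e\<in>edges G. real (snd X e))"
    if sched: "simplified_scheduler G sched" and X: "X \<in> ent_states G \<times> request_states G" for sched X
  proof -
    let ?r = "\<lambda>e. real (snd X e)"
    define p where "p = sched (snd X)"
    have "snd X \<in> request_states G" using X by auto
    with sched obtain x where p: "set_pmf p \<subseteq> matchings G" and x: "lp_optimal G ?r x" and
      "\<forall>e\<in>edges G. (\<Sum>M\<in>matchings G. pmf p M * indicator M e) = 2/3 * x e"
      unfolding simplified_scheduler_def p_def by blast
    hence px: "measure_pmf.prob p {M. e \<in> M} = 2/3 * x e" if "e \<in> edges G" for e
      using scheduler_marginal[OF G p] that by simp
    have x': "lp_feasible G x" "(\<Sum>e\<in>edges G. ?r e * y e) \<le> (\<Sum>e\<in>edges G. ?r e * x e)"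
      using x y(1) by (auto simp: lp_optimal_def)
    have cover: "(\<Sum>e\<in>incident G u. measure_pmf.prob p {M. e \<in> M}) \<le> 2/3 * gen_prob G u"
      if u: "u \<in> nodes G" for u
    proof -
      have "(\<Sum>e\<in>incident G u. measure_pmf.prob p {M. e \<in> M}) = 2/3 * (\<Sum>e\<in>incident G u. x e)"
        unfolding sum_distrib_left
        by (rule sum.cong) (use px incident_subset[OF G] in auto)
      thus ?thesis using x'(1) u by (auto simp: lp_feasible_def)
    qed
    have "measure_pmf.expectation (iter_pmf (slot G arr p) T X)
        (\<lambda>Y. lyapunov G (snd Y) - lyapunov G (snd X))
      \<le> (\<Sum>e\<in>edges G. ?r e * (real T * \<nu> e - measure_pmf.prob p {M. e \<in> M} * (real T * ?\<Gamma> - 2 * H))) + K"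
      unfolding K_def
      by (rule frame_lyapunov_drift[OF G arr X p cover H coherence_factor_le[OF G \<Gamma>]])
    also have "(\<Sum>e\<in>edges G. ?r e * (real T * \<nu> e - measure_pmf.prob p {M. e \<in> M} * (real T * ?\<Gamma> - 2 * H)))
        \<le> (\<Sum>e\<in>edges G. ?r e * (real T * \<kappa> * \<nu>' e - x e * (real T * \<kappa>)))"
    proof (rule sum_mono, rule mult_left_mono)
      fix e assume e: "e \<in> edges G"
      have "0 \<le> x e" using x'(1) e by (simp add: lp_feasible_def)
      hence "x e * (real T * \<kappa>) \<le> x e * (2/3 * (real T * ?\<Gamma> - 2 * H))"
        using rate by (intro mult_left_mono) auto
      thus "real T * \<nu> e - measure_pmf.prob p {M. e \<in> M} * (real T * ?\<Gamma> - 2 * H)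
          \<le> real T * \<kappa> * \<nu>' e - x e * (real T * \<kappa>)"
        by (simp add: px[OF e] \<nu>' algebra_simps)
    qed auto
    also have "\<dots> = real T * \<kappa> * ((\<Sum>e\<in>edges G. ?r e * \<nu>' e) - (\<Sum>e\<in>edges G. ?r e * x e))"
      by (simp add: sum_subtractf[symmetric] sum_distrib_left algebra_simps)
    also have "\<dots> \<le> real T * \<kappa> * (- \<eta> * (\<Sum>e\<in>edges G. ?r e))"
    proof (rule mult_left_mono)
      have "(\<Sum>e\<in>edges G. ?r e * (\<nu>' e + \<eta>)) \<le> (\<Sum>e\<in>edges G. ?r e * y e)"
        by (intro sum_mono mult_left_mono y) auto
      hence "(\<Sum>e\<in>edges G. ?r e * \<nu>' e) + \<eta> * (\<Sum>e\<in>edges G. ?r e) \<le> (\<Sum>e\<in>edges G. ?r e * x e)"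
        using x'(2) by (simp add: algebra_simps sum.distrib sum_distrib_left)
      thus "(\<Sum>e\<in>edges G. ?r e * \<nu>' e) - (\<Sum>e\<in>edges G. ?r e * x e) \<le> - \<eta> * (\<Sum>e\<in>edges G. ?r e)"
        by simp
    qed (use \<kappa> in simp)
    finally show ?thesis by (simp add: p_def mult_ac)
  qed
  moreover have "0 < real T * \<kappa> * \<eta>" using T1 \<kappa> \<eta> by simp
  ultimately show ?thesis using T1 by blast
qed

(* The conditional expectation given (L(kT), R(kT)) = (l, r) is the expectation under the law of
   the trajectory conditioned on that event. An integral that did not exist would be 0, so the
   final bound includes integrability. *)

theorem mainTheorem4:
  fixes G :: "'v switch"
    and arr :: "('v set \<Rightarrow> nat) pmf"
    and \<nu> :: "'v set \<Rightarrow> real"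
    and \<epsilon> :: real
  assumes "valid_switch G"
    and "request_arrivals G \<nu> arr"
    and "0 < coherence_factor G"
    and "0 < \<epsilon>"
    and "(\<lambda>e. (1 + \<epsilon>) / (2/3 * coherence_factor G) * \<nu> e) \<in> capacity_region G"
  shows "\<exists>(T::nat) (\<delta>::real) \<B>.
           1 \<le> T \<and> 0 < \<delta> \<and> finite \<B> \<and> \<B> \<subseteq> request_states G \<and>
           (\<forall>sched init. simplified_scheduler G sched \<and>
                set_pmf init \<subseteq> ent_states G \<times> request_states G \<longrightarrow>
              (\<forall>k l r.
                let P = trajectory G arr sched T init ((k + 1) * T);
                    E = {h. h ! (k * T) = (l, r)}
                in 0 < measure_pmf.prob P E \<and> r \<notin> \<B> \<longrightarrow>
                   measure_pmf.expectation (cond_pmf P E)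
                     (\<lambda>h. lyapunov G (snd (h ! ((k + 1) * T))) - lyapunov G (snd (h ! (k * T))))
                   \<le> - \<delta>))"
proof -
  obtain T c K where T: "1 \<le> T" and c: "0 < c" and drift: "\<And>sched X. simplified_scheduler G sched \<Longrightarrow>
      X \<in> ent_states G \<times> request_states G \<Longrightarrow>
      measure_pmf.expectation (iter_pmf (slot G arr (sched (snd X))) T X)
        (\<lambda>Y. lyapunov G (snd Y) - lyapunov G (snd X)) \<le> K - c * (\<Sum>e\<in>edges G. real (snd X e))"
    using frame_drift_bound[OF assms] by blast
  have arr: "set_pmf arr \<subseteq> request_states G"
    using assms(2) by (simp add: request_arrivals_def)
  define \<B> where "\<B> = {r \<in> request_states G. (\<Sum>e\<in>edges G. real (r e)) \<le> (K + 1) / c}"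
  have bound: "measure_pmf.expectation
        (cond_pmf (trajectory G arr sched T init ((k + 1) * T)) {h. h ! (k * T) = (l, r)})
        (\<lambda>h. lyapunov G (snd (h ! ((k + 1) * T))) - lyapunov G (snd (h ! (k * T)))) \<le> - 1"
    if sched: "simplified_scheduler G sched"
      and init: "set_pmf init \<subseteq> ent_states G \<times> request_states G"
      and pos: "0 < measure_pmf.prob (trajectory G arr sched T init ((k + 1) * T)) {h. h ! (k * T) = (l, r)}"
      and r: "r \<notin> \<B>" for sched init k l r
  proof -
    let ?P = "trajectory G arr sched T init ((k + 1) * T)"
    have "set_pmf ?P \<inter> {h. h ! (k * T) = (l, r)} \<noteq> {}"
      unfolding measure_pmf_zero_iff[symmetric] using pos by (simp only: less_irrefl not_False_eq_True order_less_imp_not_eq2)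
    then obtain h where h: "h \<in> set_pmf ?P" "h ! (k * T) = (l, r)" by blast
    have "k * T < length h"
      using length_trajectory[OF h(1)] by simp
    hence X: "(l, r) \<in> ent_states G \<times> request_states G"
      using trajectory_support[OF assms(1) arr init h(1)] h(2) nth_mem[of "k * T" h] by auto
    have "\<not> (\<Sum>e\<in>edges G. real (r e)) \<le> (K + 1) / c"
      using r X by (auto simp: \<B>_def)
    hence large: "K + 1 < c * (\<Sum>e\<in>edges G. real (r e))"
      using c by (simp add: not_le pos_divide_less_eq mult.commute)
    have "measure_pmf.expectation (cond_pmf ?P {h. h ! (k * T) = (l, r)})
        (\<lambda>h. lyapunov G (snd (h ! ((k + 1) * T))) - lyapunov G (snd (h ! (k * T))))
      = measure_pmf.expectation (iter_pmf (slot G arr (sched (snd (l, r)))) T (l, r))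
          (\<lambda>Y. lyapunov G (snd Y) - lyapunov G (snd (l, r)))"
      using pos by (rule cond_trajectory_expectation)
    also have "\<dots> \<le> K - c * (\<Sum>e\<in>edges G. real (snd (l, r) e))"
      using sched X by (rule drift)
    finally show ?thesis using large by simp
  qed
  \<comment> \<open>the bound on the drift is \<open>- 1\<close> as soon as \<open>c\<close> times the total queue exceeds \<open>K + 1\<close>\<close>
  show ?thesis
  proof (intro exI[of _ T] exI[of _ "1 :: real"] exI[of _ \<B>] conjI)
    show "finite \<B>" unfolding \<B>_def by (rule finite_request_sublevel[OF assms(1)])
  qed (use T bound in \<open>auto simp: \<B>_def Let_def\<close>)
qed

end
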